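(* Let $A,B\in\mathbb{C}^{4\times 4}$ satisfy $\operatorname{Tr}A=\operatorname{Tr}B=0$ and $\operatorname{Tr}A^\dagger A+\operatorname{Tr}B^\dagger B=\frac14$. Suppose that each of the two matrices $A$, $B$ is either normal or of the block form displayed below; that is, $A$ is normal or $$A=\begin{bmatrix}0&a_1&0&0\\ a_2&0&0&0\\ 0&0&0&a_3\\ 0&0&a_4&0\end{bmatrix}\quad\text{for some } a_1,a_2,a_3,a_4\in\mathbb{C},$$ and $B$ is normal or $$B=\begin{bmatrix}0&b_1&0&0\\ b_2&0&0&0\\ 0&0&0&b_3\\ 0&0&b_4&0\end{bmatrix}\quad\text{for some } b_1,b_2,b_3,b_4\in\mathbb{C}.$$ Let $X=A\otimes I_4+I_4\otimes B\in\mathbb{C}^{16\times16}$ and let $\sigma_1\ge\sigma_2\ge\cdots\ge\sigma_{16}$ be the singular values of $X$. Then $\sigma_1^2+\sigma_2^2\le\frac12$. (Equivalently, the supremum of $\sigma_1^2+\sigma_2^2$ over all such $X$ is at most $\frac12$.)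
   Context: $A^\dagger$ denotes the conjugate transpose of $A$, $\otimes$ the Kronecker product, and $I_n$ the $n\times n$ identity matrix. Singular values are counted with multiplicity. *)

theory Defs
  imports
    "Jordan_Normal_Form.Schur_Decomposition"
    "HOL-Computational_Algebra.Fundamental_Theorem_Algebra"
begin

definition mat_trace :: "'a :: comm_monoid_add mat \<Rightarrow> 'a" where
  "mat_trace A = (\<Sum>i<dim_row A. A $$ (i, i))"

definition kronecker :: "'a :: times mat \<Rightarrow> 'a mat \<Rightarrow> 'a mat" where
  "kronecker A B = mat (dim_row A * dim_row B) (dim_col A * dim_col B)
     (\<lambda>(i, j). A $$ (i div dim_row B, j div dim_col B) * B $$ (i mod dim_row B, j mod dim_col B))"

definition normal_mat :: "complex mat \<Rightarrow> bool" where
  "normal_mat A \<longleftrightarrow> mat_adjoint A * A = A * mat_adjoint A"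

definition offdiag_block_mat :: "complex \<Rightarrow> complex \<Rightarrow> complex \<Rightarrow> complex \<Rightarrow> complex mat" where
  "offdiag_block_mat a1 a2 a3 a4 = mat_of_rows_list 4
     [[0, a1, 0, 0],
      [a2, 0, 0, 0],
      [0, 0, 0, a3],
      [0, 0, a4, 0]]"

(* The list is in decreasing order, with one entry for each root, with multiplicity, of the
   characteristic polynomial of the Gram matrix of A. These roots are real and nonnegative
   (lemma char_poly_gram_root_nonneg), so taking the real part loses nothing.
   Lists are indexed from 0: the largest singular value is singular_values A ! 0. *)
definition singular_values :: "complex mat \<Rightarrow> real list" where
  "singular_values A = rev (sorted_list_of_multiset
     (image_mset (\<lambda>z. sqrt (Re z)) (proots (char_poly (mat_adjoint A * A)))))"

lemma mat_adjoint_carrier: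
  "A \<in> carrier_mat n m \<Longrightarrow> mat_adjoint A \<in> carrier_mat m n"
  unfolding mat_adjoint_def by auto

lemma mat_adjoint_index:
  assumes "A \<in> carrier_mat n m" "i < m" "j < n"
  shows "mat_adjoint A $$ (i, j) = conjugate (A $$ (j, i))"
  using assms unfolding mat_adjoint_def by (auto simp: mat_of_rows_def)

lemma length_singular_values:
  assumes "A \<in> carrier_mat n m"
  shows "length (singular_values A) = m"
proof -
  have "mat_adjoint A * A \<in> carrier_mat m m"
    using assms mat_adjoint_carrier[OF assms] by auto
  hence "degree (char_poly (mat_adjoint A * A)) = m"
    using degree_monic_char_poly by blast
  hence "size (proots (char_poly (mat_adjoint A * A))) = m"
    by (simp add: size_proots_complex)
  thus ?thesis
    unfolding singular_values_def
    by (metis length_rev mset_sorted_list_of_multiset size_image_mset size_mset)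
qed

lemma char_poly_gram_root_nonneg:
  assumes A: "A \<in> carrier_mat n m"
    and root: "poly (char_poly (mat_adjoint A * A)) z = 0"
  shows "z \<in> \<real>" "Re z \<ge> 0"
proof -
  let ?G = "mat_adjoint A * A"
  have Ad: "mat_adjoint A \<in> carrier_mat m n" by (rule mat_adjoint_carrier[OF A])
  have G: "?G \<in> carrier_mat m m" using A Ad by auto
  from root obtain v where ev: "eigenvector ?G v z"
    using eigenvalue_root_char_poly[OF G] unfolding eigenvalue_def by blast
  have v: "v \<in> carrier_vec m" "v \<noteq> 0\<^sub>v m" "?G *\<^sub>v v = z \<cdot>\<^sub>v v"
    using ev G unfolding eigenvector_def by auto
  define w where "w = A *\<^sub>v v"
  have w: "w \<in> carrier_vec n" unfolding w_def using A v by auto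
  have Gv: "?G *\<^sub>v v = mat_adjoint A *\<^sub>v w"
    unfolding w_def using A Ad v by auto
  have "(mat_adjoint A *\<^sub>v w) \<bullet> conjugate v =
      (\<Sum>i<m. (\<Sum>j<n. cnj (A $$ (j, i)) * w $ j) * cnj (v $ i))"
    using A Ad v w
    by (auto simp: scalar_prod_def mat_adjoint_index[OF A] atLeast0LessThan
        intro!: sum.cong arg_cong2[of _ _ _ _ "(*)"])
  also have "\<dots> = (\<Sum>j<n. w $ j * cnj (\<Sum>i<m. A $$ (j, i) * v $ i))"
    unfolding sum_distrib_left sum_distrib_right cnj_sum
    by (subst sum.swap) (simp add: mult_ac)
  also have "\<dots> = w \<bullet> conjugate w"
    using A v w unfolding scalar_prod_def
    by (auto simp: w_def scalar_prod_def atLeast0LessThan intro!: sum.cong)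
  finally have eq: "z * (v \<bullet>c v) = w \<bullet>c w"
    using v Gv by (auto simp: smult_scalar_prod_distrib[of _ m])
  have *: "u \<bullet>c u = of_real (\<Sum>i<k. (cmod (u $ i))\<^sup>2)" if "u \<in> carrier_vec k" for u k
    using that unfolding scalar_prod_def of_real_sum
    by (auto simp: atLeast0LessThan complex_norm_square simp del: of_real_power intro!: sum.cong)
  define s t where "s = (\<Sum>i<m. (cmod (v $ i))\<^sup>2)" and "t = (\<Sum>i<n. (cmod (w $ i))\<^sup>2)"
  have st: "z * of_real s = of_real t" using eq *[OF v(1)] *[OF w] unfolding s_def t_def by simp
  have "s \<ge> 0" "t \<ge> 0" unfolding s_def t_def by (auto intro: sum_nonneg)
  moreover have "s \<noteq> 0"
    using v(2) conjugate_square_eq_0_vec[OF v(1)] *[OF v(1), folded s_def] by (metis of_real_0)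
  ultimately have "z = of_real (t / s)" "t / s \<ge> 0" using st by (auto simp: field_simps)
  thus "z \<in> \<real>" "Re z \<ge> 0" by auto
qed

end

theory Submission
  imports Defs
begin

text \<open>
  A unitary change of basis in each tensor factor makes a normal factor diagonal. Write \<open>S\<close> for the
  sum of the squared Frobenius norms of \<open>A\<close> and \<open>B\<close>; the claim is that any two eigenvalues of the Gram
  matrix of \<open>X\<close> sum to at most \<open>2 S\<close>.

  If both factors are diagonal, the eigenvalues are \<open>\<bar>a\<^sub>i + b\<^sub>j\<bar>\<^sup>2\<close>, and the vanishing traces give the bound.
  If both have the off-diagonal form, every row of \<open>X\<close> has two nonzero entries and Cauchy-Schwarz shows
  that each eigenvalue is already at most \<open>S\<close>. If \<open>A\<close> is diagonal and \<open>B\<close> off-diagonal, \<open>X\<close> splits into eight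
  blocks \<open>[[a, b], [c, a]]\<close>, where \<open>a\<close> is an eigenvalue of \<open>A\<close>. With \<open>N = \<bar>b\<bar>\<^sup>2 + \<bar>c\<bar>\<^sup>2\<close>, each eigenvalue of the Gram
  matrix of such a block is at most \<open>2 \<bar>a\<bar>\<^sup>2 + N\<close> (used for two blocks with different \<open>a\<close>) and at
  most \<open>4/3 \<bar>a\<bar>\<^sup>2 + 2 N\<close> (used for two blocks with the same \<open>a\<close>, since \<open>4/3 \<bar>a\<bar>\<^sup>2\<close> is at most the squared norm
  of the traceless \<open>A\<close>), and its trace \<open>2 \<bar>a\<bar>\<^sup>2 + N\<close> handles two eigenvalues of one block.
  The remaining case follows by flipping the tensor factors.
\<close>

subsection \<open>Adjoints, unitary matrices and traces\<close>

lemma mat_mult_index_sum: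
  assumes "A \<in> carrier_mat n m" "B \<in> carrier_mat m k" "i < n" "j < k"
  shows "(A * B) $$ (i, j) = (\<Sum>r<m. A $$ (i, r) * B $$ (r, j))"
  using assms by (auto simp: scalar_prod_def atLeast0LessThan intro!: sum.cong)

lemma mat_adjoint_index_complex:
  fixes A :: "complex mat"
  assumes "A \<in> carrier_mat n m" "i < m" "j < n"
  shows "mat_adjoint A $$ (i, j) = cnj (A $$ (j, i))"
  using mat_adjoint_index[OF assms] by simp

lemma gram_index:
  fixes A :: "complex mat"
  assumes A: "A \<in> carrier_mat n m" and ij: "i < m" "j < m"
  shows "(mat_adjoint A * A) $$ (i, j) = (\<Sum>r<n. cnj (A $$ (r, i)) * A $$ (r, j))"
  by (subst mat_mult_index_sum[OF mat_adjoint_carrier[OF A] A ij])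
     (simp add: mat_adjoint_index_complex[OF A ij(1)])

lemma mat_adjoint_mult:
  fixes A B :: "complex mat"
  assumes A: "A \<in> carrier_mat n m" and B: "B \<in> carrier_mat m k"
  shows "mat_adjoint (A * B) = mat_adjoint B * mat_adjoint A"
proof (rule eq_matI)
  note adj = mat_adjoint_carrier[OF A] mat_adjoint_carrier[OF B]
    mat_adjoint_carrier[OF mult_carrier_mat[OF A B]]
  show "dim_row (mat_adjoint (A * B)) = dim_row (mat_adjoint B * mat_adjoint A)"
    "dim_col (mat_adjoint (A * B)) = dim_col (mat_adjoint B * mat_adjoint A)"
    using adj by auto
  fix i j assume "i < dim_row (mat_adjoint B * mat_adjoint A)"
    "j < dim_col (mat_adjoint B * mat_adjoint A)"
  then have ij: "i < k" "j < n" using adj by auto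
  show "mat_adjoint (A * B) $$ (i, j) = (mat_adjoint B * mat_adjoint A) $$ (i, j)"
    by (simp only: mat_adjoint_index_complex[OF mult_carrier_mat[OF A B] ij]
        mat_mult_index_sum[OF A B ij(2,1)] mat_mult_index_sum[OF adj(2,1) ij])
       (auto simp: mat_adjoint_index_complex[OF A _ ij(2)] mat_adjoint_index_complex[OF B ij(1)]
         intro!: sum.cong)
qed

lemma mat_adjoint_adjoint:
  fixes A :: "complex mat"
  assumes A: "A \<in> carrier_mat n m"
  shows "mat_adjoint (mat_adjoint A) = A"
proof (rule eq_matI)
  note adj = mat_adjoint_carrier[OF A] mat_adjoint_carrier[OF mat_adjoint_carrier[OF A]]
  show "dim_row (mat_adjoint (mat_adjoint A)) = dim_row A"
    "dim_col (mat_adjoint (mat_adjoint A)) = dim_col A" using adj A by auto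
  fix i j assume "i < dim_row A" "j < dim_col A"
  then have "i < n" "j < m" using A by auto
  then show "mat_adjoint (mat_adjoint A) $$ (i, j) = A $$ (i, j)"
    by (simp add: mat_adjoint_index_complex[OF adj(1)] mat_adjoint_index_complex[OF A])
qed

text \<open>Only orthonormality of the columns is demanded; for a square matrix the reverse identity
  follows, as \<open>unitary_matD\<close> shows.\<close>

definition unitary_mat :: "nat \<Rightarrow> complex mat \<Rightarrow> bool" where
  "unitary_mat n U \<longleftrightarrow> U \<in> carrier_mat n n \<and> mat_adjoint U * U = 1\<^sub>m n"

lemma unitary_matD:
  assumes "unitary_mat n U"
  shows "U \<in> carrier_mat n n" "mat_adjoint U \<in> carrier_mat n n"
    "mat_adjoint U * U = 1\<^sub>m n" "U * mat_adjoint U = 1\<^sub>m n"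
proof -
  show U: "U \<in> carrier_mat n n" and UU: "mat_adjoint U * U = 1\<^sub>m n"
    using assms unfolding unitary_mat_def by auto
  show U': "mat_adjoint U \<in> carrier_mat n n" by (rule mat_adjoint_carrier[OF U])
  show "U * mat_adjoint U = 1\<^sub>m n"
    by (rule mat_mult_left_right_inverse[OF U' U UU])
qed

lemma unitary_matI_index:
  assumes U: "U \<in> carrier_mat n n"
    and "\<And>i j. i < n \<Longrightarrow> j < n \<Longrightarrow>
      (\<Sum>r<n. cnj (U $$ (r, i)) * U $$ (r, j)) = (if i = j then 1 else 0)"
  shows "unitary_mat n U"
  unfolding unitary_mat_def
proof (intro conjI U eq_matI)
  fix i j assume "i < dim_row (1\<^sub>m n :: complex mat)" "j < dim_col (1\<^sub>m n :: complex mat)"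
  then have ij: "i < n" "j < n" by auto
  show "(mat_adjoint U * U) $$ (i, j) = 1\<^sub>m n $$ (i, j)"
    using assms(2)[OF ij] ij by (simp only: gram_index[OF U ij]) simp
qed (use U mat_adjoint_carrier[OF U] in auto)

lemma unitary_mat_one: "unitary_mat n (1\<^sub>m n)"
proof (rule unitary_matI_index)
  fix i j assume "i < n" "j < n"
  then have "(\<Sum>r<n. cnj (1\<^sub>m n $$ (r, i)) * 1\<^sub>m n $$ (r, j)) =
      (\<Sum>r<n. if r = i then (if i = j then 1 else 0) else 0 :: complex)"
    by (intro sum.cong) auto
  then show "(\<Sum>r<n. cnj (1\<^sub>m n $$ (r, i)) * 1\<^sub>m n $$ (r, j)) = (if i = j then 1 else 0 :: complex)"
    using \<open>i < n\<close> by simp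
qed auto

lemma unitary_mat_mult:
  assumes "unitary_mat n U" "unitary_mat n V"
  shows "unitary_mat n (U * V)"
proof -
  note U = unitary_matD[OF assms(1)] and V = unitary_matD[OF assms(2)]
  have "mat_adjoint (U * V) * (U * V) = mat_adjoint V * (mat_adjoint U * U) * V"
    unfolding mat_adjoint_mult[OF U(1) V(1)] using U(1,2) V(1,2)
    by (simp add: assoc_mult_mat[of _ n n _ n _ n])
  then show ?thesis using U V unfolding unitary_mat_def by simp
qed

section \<open>Traces, and Gram matrices under a unitary change of basis\<close>

lemma mat_trace_mult_comm:
  fixes A B :: "'a :: comm_semiring_0 mat"
  assumes A: "A \<in> carrier_mat n m" and B: "B \<in> carrier_mat m n"
  shows "mat_trace (A * B) = mat_trace (B * A)"
proof -
  have "mat_trace (A * B) = (\<Sum>i<n. \<Sum>r<m. A $$ (i, r) * B $$ (r, i))"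
    unfolding mat_trace_def using A by (auto simp: mat_mult_index_sum[OF A B] intro!: sum.cong simp del: index_mult_mat(1))
  also have "\<dots> = (\<Sum>r<m. \<Sum>i<n. B $$ (r, i) * A $$ (i, r))"
    by (subst sum.swap) (simp add: mult.commute)
  also have "\<dots> = mat_trace (B * A)"
    unfolding mat_trace_def using B by (auto simp: mat_mult_index_sum[OF B A] intro!: sum.cong simp del: index_mult_mat(1))
  finally show ?thesis .
qed

lemma mat_trace_similar:
  fixes A B :: "'a :: comm_ring_1 mat"
  assumes "similar_mat A B"
  shows "mat_trace A = mat_trace B"
proof -
  obtain n P Q where c: "A \<in> carrier_mat n n" "B \<in> carrier_mat n n" "P \<in> carrier_mat n n"
      "Q \<in> carrier_mat n n" and QP: "Q * P = 1\<^sub>m n" and A: "A = P * B * Q"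
    using similar_matD[OF assms] by auto
  have "mat_trace A = mat_trace (Q * (P * B))"
    unfolding A by (rule mat_trace_mult_comm) (use c in auto)
  also have "Q * (P * B) = B" using c QP by (simp flip: assoc_mult_mat[of Q n n P n B n])
  finally show ?thesis .
qed

lemma mat_trace_gram:
  fixes A :: "complex mat"
  assumes A: "A \<in> carrier_mat n m"
  shows "mat_trace (mat_adjoint A * A) = of_real (\<Sum>j<m. \<Sum>i<n. (cmod (A $$ (i, j)))\<^sup>2)"
proof -
  have "mat_trace (mat_adjoint A * A) = (\<Sum>j<m. (mat_adjoint A * A) $$ (j, j))"
    unfolding mat_trace_def using mat_adjoint_carrier[OF A] by auto
  also have "\<dots> = (\<Sum>j<m. \<Sum>r<n. cnj (A $$ (r, j)) * A $$ (r, j))"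
    by (intro sum.cong refl gram_index[OF A]) auto
  also have "\<dots> = of_real (\<Sum>j<m. \<Sum>i<n. (cmod (A $$ (i, j)))\<^sup>2)"
    by (simp add: complex_norm_square mult.commute del: of_real_power)
  finally show ?thesis .
qed

text \<open>Since \<open>X\<close> equals \<open>U * Y * mat_adjoint U\<close>, the inner factor
  \<open>mat_adjoint U * U\<close> of its Gram matrix cancels, and \<open>U\<close> conjugates one
  Gram matrix into the other. Hence \<open>X\<close> and \<open>Y\<close> have the same singular
  values.\<close>

lemma gram_eq_conj:
  assumes X: "X \<in> carrier_mat n n" and Y: "Y \<in> carrier_mat n n"
    and U: "unitary_mat n U" and eq: "X * U = U * Y"
  shows "similar_mat (mat_adjoint X * X) (mat_adjoint Y * Y)"
proof (rule similar_matI)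
  note u = unitary_matD[OF U]
  have c: "mat_adjoint X \<in> carrier_mat n n" "mat_adjoint Y \<in> carrier_mat n n"
    using X Y mat_adjoint_carrier by auto
  show "{mat_adjoint X * X, mat_adjoint Y * Y, U, mat_adjoint U} \<subseteq> carrier_mat n n"
    using X Y c u by auto
  show "U * mat_adjoint U = 1\<^sub>m n" "mat_adjoint U * U = 1\<^sub>m n" by fact+
  have "X = X * (U * mat_adjoint U)" using X u by simp
  also have "\<dots> = U * Y * mat_adjoint U"
    using X u(1,2) by (simp add: eq flip: assoc_mult_mat[of _ n n _ n _ n])
  finally have XX: "X = U * Y * mat_adjoint U" .
  have "mat_adjoint X = U * mat_adjoint Y * mat_adjoint U"
    unfolding XX using u(1,2) c Y
    by (simp add: mat_adjoint_mult[of _ n n _ n] mat_adjoint_adjoint[OF u(1)]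
        assoc_mult_mat[of _ n n _ n _ n])
  then have "mat_adjoint X * X = U * mat_adjoint Y * (mat_adjoint U * U) * Y * mat_adjoint U"
    using u(1,2) c Y XX by (simp add: assoc_mult_mat[of _ n n _ n _ n])
  then show "mat_adjoint X * X = U * (mat_adjoint Y * Y) * mat_adjoint U"
    using u c Y by (simp add: assoc_mult_mat[of _ n n _ n _ n])
qed

subsection \<open>Unitary diagonalization of normal matrices\<close>

text \<open>Complete \<open>v\<close> to a basis, orthogonalize and normalize. Gram-Schmidt leaves
  its first vector unchanged, so column 0 is a multiple of \<open>v\<close>.\<close>

lemma ex_unitary_first_col:
  fixes v :: "complex vec"
  assumes v: "v \<in> carrier_vec n" and v0: "v \<noteq> 0\<^sub>v n"
  obtains U c where "unitary_mat n U" "c \<noteq> 0" "col U 0 = c \<cdot>\<^sub>v v"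
proof -
  interpret cof_vec_space n "TYPE(complex)" .
  define b where "b = basis_completion v"
  define ws where "ws = gram_schmidt n b"
  have n: "n \<noteq> 0" using v v0 by (cases n) auto
  note bc = basis_completion[OF v v0, folded b_def]
  from bc n obtain vs where b: "b = v # vs" by (cases b) auto
  have gs: "set ws \<subseteq> carrier_vec n" "corthogonal ws" "length ws = n"
    using gram_schmidt_result[of b ws] bc unfolding ws_def by auto
  have hd: "hd ws = v" using gram_schmidt_hd[OF v, of vs] b unfolding ws_def by auto
  have ws0: "ws ! 0 = v" using hd gs n by (metis hd_conv_nth length_0_conv)
  have wsc: "ws ! i \<in> carrier_vec n" if "i < n" for i using gs that by auto
  define s where "s i = (\<Sum>r<n. (cmod (ws ! i $ r))\<^sup>2)" for i
  define U where "U = mat n n (\<lambda>(r, i). ws ! i $ r / of_real (sqrt (s i)))"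
  have inner: "(\<Sum>r<n. cnj (ws ! i $ r) * ws ! j $ r) = ws ! j \<bullet>c ws ! i"
    if "i < n" "j < n" for i j
    using wsc[OF that(1)] wsc[OF that(2)] by (auto simp: scalar_prod_def atLeast0LessThan mult.commute intro!: sum.cong)
  have self: "(\<Sum>r<n. cnj (ws ! i $ r) * ws ! i $ r) = of_real (s i)" for i
    unfolding s_def of_real_sum
    by (intro sum.cong) (simp_all add: complex_norm_square mult.commute del: of_real_power)
  \<comment> \<open>\<open>corthogonal\<close> also says that each vector has a nonzero inner
    product with itself, so the normalization does not divide by 0.\<close>
  have s0: "s i > 0" if "i < n" for i
  proof -
    have "s i \<ge> 0" unfolding s_def by (intro sum_nonneg) auto
    moreover have "s i \<noteq> 0"
      using self[of i] inner[OF that that] corthogonalD[OF gs(2), of i i] gs(3) that by auto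
    ultimately show ?thesis by simp
  qed
  have "unitary_mat n U"
  proof (rule unitary_matI_index)
    fix i j assume ij: "i < n" "j < n"
    have "(\<Sum>r<n. cnj (U $$ (r, i)) * U $$ (r, j)) =
        (\<Sum>r<n. cnj (ws ! i $ r) * ws ! j $ r) / of_real (sqrt (s i) * sqrt (s j))"
      unfolding U_def sum_divide_distrib using ij by (intro sum.cong) auto
    also have "\<dots> = (if i = j then 1 else 0)"
    proof (cases "i = j")
      case True
      then show ?thesis using s0[OF ij(1)] self[of i] by simp
    next
      case False
      then show ?thesis using inner[OF ij] corthogonalD[OF gs(2), of j i] gs(3) ij by simp
    qed
    finally show "(\<Sum>r<n. cnj (U $$ (r, i)) * U $$ (r, j)) = (if i = j then 1 else 0)" .
  qed (simp add: U_def)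
  moreover have "col U 0 = (1 / of_real (sqrt (s 0))) \<cdot>\<^sub>v v"
    using n v by (intro eq_vecI) (auto simp: U_def ws0)
  moreover have "1 / complex_of_real (sqrt (s 0)) \<noteq> 0" using s0[of 0] n by simp
  ultimately show thesis using that by blast
qed

text \<open>Conjugation by \<open>U\<close> respects products, because the inner
  \<open>U * mat_adjoint U\<close> cancels, and it respects adjoints.\<close>

lemma normal_mat_unitary_conj:
  assumes A: "A \<in> carrier_mat n n" and N: "normal_mat A" and U: "unitary_mat n U"
  shows "normal_mat (mat_adjoint U * A * U)"
proof -
  note u = unitary_matD[OF U]
  have A': "mat_adjoint A \<in> carrier_mat n n" by (rule mat_adjoint_carrier[OF A])
  have adj: "mat_adjoint (mat_adjoint U * A * U) = mat_adjoint U * mat_adjoint A * U"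
    using A u(1,2) A' by (simp add: mat_adjoint_mult[of _ n n _ n] mat_adjoint_adjoint[OF u(1)]
        assoc_mult_mat[of _ n n _ n _ n])
  have cancel: "mat_adjoint U * B * U * (mat_adjoint U * C * U) = mat_adjoint U * (B * C) * U"
    if "B \<in> carrier_mat n n" "C \<in> carrier_mat n n" for B C
  proof -
    have "mat_adjoint U * B * U * (mat_adjoint U * C * U) =
        mat_adjoint U * B * (U * mat_adjoint U) * C * U"
      using that u(1,2) by (simp add: assoc_mult_mat[of _ n n _ n _ n])
    then show ?thesis using that u by (simp add: assoc_mult_mat[of _ n n _ n _ n])
  qed
  show ?thesis using N unfolding normal_mat_def adj cancel[OF A' A] cancel[OF A A'] by simp
qed

text \<open>The (0, 0) entries of the two products in \<open>normal_mat\<close> are the squared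
  norms of column 0 and of row 0. If the column is supported on the corner, the corner uses up the
  whole norm of the row.\<close>

lemma normal_mat_first_row:
  assumes A: "A \<in> carrier_mat (Suc n) (Suc n)" and N: "normal_mat A"
    and col: "\<And>i. i < n \<Longrightarrow> A $$ (Suc i, 0) = 0"
    and j: "j < n"
  shows "A $$ (0, Suc j) = 0"
proof -
  note A' = mat_adjoint_carrier[OF A]
  have "(mat_adjoint A * A) $$ (0, 0) = (\<Sum>r<Suc n. cnj (A $$ (r, 0)) * A $$ (r, 0))"
    by (rule gram_index[OF A]) auto
  also have "\<dots> = of_real ((cmod (A $$ (0, 0)))\<^sup>2)"
    using col by (simp add: sum.lessThan_Suc_shift complex_norm_square mult.commute
        del: sum.lessThan_Suc of_real_power)
  finally have 1: "(mat_adjoint A * A) $$ (0, 0) = of_real ((cmod (A $$ (0, 0)))\<^sup>2)" .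
  have "(A * mat_adjoint A) $$ (0, 0) = (\<Sum>r<Suc n. A $$ (0, r) * cnj (A $$ (0, r)))"
    by (simp add: mat_mult_index_sum[OF A A'] mat_adjoint_index_complex[OF A]
        del: sum.lessThan_Suc index_mult_mat(1))
  also have "\<dots> = of_real (\<Sum>r<Suc n. (cmod (A $$ (0, r)))\<^sup>2)"
    unfolding of_real_sum by (simp add: complex_norm_square del: of_real_power sum.lessThan_Suc)
  finally have "(\<Sum>r<Suc n. (cmod (A $$ (0, r)))\<^sup>2) = (cmod (A $$ (0, 0)))\<^sup>2"
    using 1 N unfolding normal_mat_def by (metis of_real_eq_iff)
  then have "(\<Sum>r<n. (cmod (A $$ (0, Suc r)))\<^sup>2) = 0"
    by (simp add: sum.lessThan_Suc_shift del: sum.lessThan_Suc)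
  then show ?thesis using j by (subst (asm) sum_nonneg_eq_0_iff) auto
qed

text \<open>\<open>W\<close> is the block matrix diag(1, \<open>V\<close>), which lifts a
  diagonalization of a lower right block to the full matrix.\<close>

lemma unitary_mat_block:
  assumes V: "unitary_mat n V"
  defines "W \<equiv> mat (Suc n) (Suc n) (\<lambda>(i, j). if i = 0 \<or> j = 0 then (if i = j then 1 else 0)
      else V $$ (i - 1, j - 1))"
  shows "unitary_mat (Suc n) W"
proof (rule unitary_matI_index)
  fix i j assume ij: "i < Suc n" "j < Suc n"
  have "(\<Sum>r<n. cnj (V $$ (r, i)) * V $$ (r, j)) = (if i = j then 1 else 0)" if "i < n" "j < n" for i j
    using gram_index[OF unitary_matD(1)[OF V] that] unitary_matD(3)[OF V] that by simp
  then show "(\<Sum>r<Suc n. cnj (W $$ (r, i)) * W $$ (r, j)) = (if i = j then 1 else 0)"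
    using ij unfolding W_def by (cases i; cases j) (auto simp: sum.lessThan_Suc_shift simp del: sum.lessThan_Suc)
qed (simp add: W_def)

text \<open>The spectral theorem by deflation: with a unit eigenvector as first basis vector,
  normality splits the matrix into the eigenvalue and a smaller normal block. The form
  \<open>A * U = U * D\<close> is the one that \<open>kron_sum_conj\<close> takes.\<close>

theorem normal_mat_unitary_diag:
  assumes "A \<in> carrier_mat n n" "normal_mat A"
  shows "\<exists>U D. unitary_mat n U \<and> D \<in> carrier_mat n n \<and> diagonal_mat D \<and> A * U = U * D"
  using assms
proof (induction n arbitrary: A)
  case 0
  then have "A * 1\<^sub>m 0 = 1\<^sub>m 0 * A" "diagonal_mat A" by (auto simp: diagonal_mat_def)
  then show ?case using unitary_mat_one[of 0] 0 by blast
next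
  case (Suc n)
  let ?n = "Suc n"
  note A = Suc.prems(1)
  obtain as where "char_poly A = (\<Prod>a\<leftarrow>as. [:- a, 1:])" "length as = ?n"
    using char_poly_factorized[OF A] by blast
  then obtain e where "poly (char_poly A) e = 0" by (cases as) auto
  then obtain v where "eigenvector A v e"
    using eigenvalue_root_char_poly[OF A] unfolding eigenvalue_def by blast
  then have v: "v \<in> carrier_vec ?n" "v \<noteq> 0\<^sub>v ?n" "A *\<^sub>v v = e \<cdot>\<^sub>v v"
    using A unfolding eigenvector_def by auto
  obtain U c where U: "unitary_mat ?n U" and c: "c \<noteq> 0" "col U 0 = c \<cdot>\<^sub>v v"
    by (rule ex_unitary_first_col[OF v(1,2)])
  note u = unitary_matD[OF U]
  define B where "B = mat_adjoint U * A * U"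
  have B: "B \<in> carrier_mat ?n ?n" unfolding B_def using A u by auto
  have NB: "normal_mat B" unfolding B_def by (rule normal_mat_unitary_conj[OF A Suc.prems(2) U])
  have AU: "A * U = U * B"
  proof -
    have "U * B = (U * mat_adjoint U) * A * U"
      unfolding B_def using A u(1,2) by (simp add: assoc_mult_mat[of _ ?n ?n _ ?n _ ?n])
    then show ?thesis using A u by simp
  qed
  have Ac: "A *\<^sub>v col U 0 = e \<cdot>\<^sub>v col U 0"
    unfolding c(2) using A v by (simp add: mult_mat_vec smult_smult_assoc mult.commute)
  \<comment> \<open>Column 0 of \<open>U\<close> is an eigenvector, so column 0 of \<open>B\<close>
    is \<open>e\<close> times column 0 of \<open>mat_adjoint U * U\<close>.\<close>
  have Bcol: "B $$ (i, 0) = (if i = 0 then e else 0)" if i: "i < ?n" for i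
  proof -
    have "B $$ (i, 0) = row (mat_adjoint U) i \<bullet> col (A * U) 0"
      unfolding B_def using A u(1,2) i by (simp add: assoc_mult_mat[of _ ?n ?n _ ?n _ ?n])
    also have "col (A * U) 0 = e \<cdot>\<^sub>v col U 0" by (simp only: col_mult2[OF A u(1) zero_less_Suc] Ac)
    also have "row (mat_adjoint U) i \<bullet> (e \<cdot>\<^sub>v col U 0) = e * (mat_adjoint U * U) $$ (i, 0)"
      using u(1,2) i by (simp add: scalar_prod_smult_distrib[of _ ?n])
    finally show ?thesis using i unfolding u(3) by simp
  qed
  have Brow: "B $$ (0, j) = (if j = 0 then e else 0)" if j: "j < ?n" for j
    using normal_mat_first_row[OF B NB, of "j - 1"] Bcol j by (cases j) auto
  define C where "C = mat n n (\<lambda>(i, j). B $$ (Suc i, Suc j))"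
  have C: "C \<in> carrier_mat n n" by (simp add: C_def)
  \<comment> \<open>The border of \<open>B\<close> outside the corner vanishes, so both products for
    \<open>C\<close> are the lower right parts of those for \<open>B\<close>.\<close>
  have "normal_mat C"
    unfolding normal_mat_def
  proof (rule eq_matI)
    note C' = mat_adjoint_carrier[OF C] and B' = mat_adjoint_carrier[OF B]
    show "dim_row (mat_adjoint C * C) = dim_row (C * mat_adjoint C)"
      "dim_col (mat_adjoint C * C) = dim_col (C * mat_adjoint C)" using C C' by auto
    fix i j assume "i < dim_row (C * mat_adjoint C)" "j < dim_col (C * mat_adjoint C)"
    then have ij: "i < n" "j < n" using C C' by auto
    have "(mat_adjoint C * C) $$ (i, j) = (mat_adjoint B * B) $$ (Suc i, Suc j)"
      using ij Brow by (simp add: gram_index[OF C] gram_index[OF B] sum.lessThan_Suc_shift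
          del: index_mult_mat(1) sum.lessThan_Suc) (simp add: C_def)
    also have "\<dots> = (B * mat_adjoint B) $$ (Suc i, Suc j)" using NB unfolding normal_mat_def by simp
    also have "\<dots> = (C * mat_adjoint C) $$ (i, j)"
      using ij Bcol
      by (simp add: mat_mult_index_sum[OF B B'] mat_mult_index_sum[OF C C'] mat_adjoint_index_complex[OF C]
          mat_adjoint_index_complex[OF B] sum.lessThan_Suc_shift
          del: index_mult_mat(1) sum.lessThan_Suc) (simp add: C_def)
    finally show "(mat_adjoint C * C) $$ (i, j) = (C * mat_adjoint C) $$ (i, j)" .
  qed
  from Suc.IH[OF C this] obtain V D where V: "unitary_mat n V" and D: "D \<in> carrier_mat n n"
    "diagonal_mat D" and CV: "C * V = V * D" by blast
  note v' = unitary_matD[OF V]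
  define W where "W = mat ?n ?n (\<lambda>(i, j). if i = 0 \<or> j = 0 then (if i = j then 1 else 0)
      else V $$ (i - 1, j - 1))"
  have W: "unitary_mat ?n W" unfolding W_def by (rule unitary_mat_block[OF V])
  note w = unitary_matD[OF W]
  define E where "E = mat ?n ?n (\<lambda>(i, j). if i = 0 \<or> j = 0 then (if i = j then e else 0)
      else D $$ (i - 1, j - 1))"
  have E: "E \<in> carrier_mat ?n ?n" by (simp add: E_def)
  have "diagonal_mat E" using D unfolding diagonal_mat_def E_def by auto
  \<comment> \<open>In block form: diag(\<open>e\<close>, \<open>C\<close>) diag(1,
    \<open>V\<close>) = diag(1, \<open>V\<close>) diag(\<open>e\<close>, \<open>D\<close>).\<close>
  have BW: "B * W = W * E"
  proof (rule eq_matI)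
    fix i j assume "i < dim_row (W * E)" "j < dim_col (W * E)"
    then have ij: "i < ?n" "j < ?n" using w E by auto
    have cv: "(\<Sum>r<n. C $$ (i, r) * V $$ (r, j)) = (\<Sum>r<n. V $$ (i, r) * D $$ (r, j))"
      if "i < n" "j < n" for i j
      using CV mat_mult_index_sum[OF C v'(1) that] mat_mult_index_sum[OF v'(1) D(1) that] by simp
    show "(B * W) $$ (i, j) = (W * E) $$ (i, j)"
      unfolding mat_mult_index_sum[OF B w(1) ij] mat_mult_index_sum[OF w(1) E ij]
      using ij Brow Bcol cv
      by (cases i; cases j)
         (auto simp: sum.lessThan_Suc_shift W_def E_def C_def simp del: sum.lessThan_Suc)
  qed (use w E B in auto)
  have "A * (U * W) = (U * W) * E"
  proof -
    have "A * (U * W) = (A * U) * W" using A u w by (simp add: assoc_mult_mat[of _ ?n ?n _ ?n _ ?n])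
    also have "\<dots> = U * (B * W)" unfolding AU using B u w by (simp add: assoc_mult_mat[of _ ?n ?n _ ?n _ ?n])
    also have "\<dots> = (U * W) * E" unfolding BW using E u w by (simp add: assoc_mult_mat[of _ ?n ?n _ ?n _ ?n])
    finally show ?thesis .
  qed
  then show ?case using unitary_mat_mult[OF U W] E \<open>diagonal_mat E\<close> by blast
qed

subsection \<open>Kronecker sums\<close>

text \<open>The range is cut into \<open>m\<close> consecutive stretches of length \<open>n\<close>;
  this turns a sum over a Kronecker index into a double sum over the indices of the factors.\<close>

lemma sum_div_mod:
  fixes f :: "nat \<Rightarrow> nat \<Rightarrow> 'a :: comm_monoid_add"
  shows "(\<Sum>r<m * n. f (r div n) (r mod n)) = (\<Sum>i<m. \<Sum>j<n. f i j)"
proof -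
  have "(\<Sum>r<m * n. f (r div n) (r mod n)) = (\<Sum>i<m. \<Sum>r = i * n..<i * n + n. f (r div n) (r mod n))"
    by (rule sum.nat_group[symmetric])
  also have "\<dots> = (\<Sum>i<m. \<Sum>j<n. f i j)"
  proof (rule sum.cong[OF refl])
    fix i
    have "(\<Sum>r = i * n..<i * n + n. f (r div n) (r mod n)) =
        (\<Sum>j = 0..<n. f ((j + i * n) div n) ((j + i * n) mod n))"
      using sum.shift_bounds_nat_ivl[of "\<lambda>r. f (r div n) (r mod n)" 0 "i * n" n]
      by (simp add: add.commute)
    also have "\<dots> = (\<Sum>j<n. f i j)" unfolding atLeast0LessThan by (intro sum.cong) auto
    finally show "(\<Sum>r = i * n..<i * n + n. f (r div n) (r mod n)) = (\<Sum>j<n. f i j)" .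
  qed
  finally show ?thesis .
qed

section \<open>Kronecker products: entries, mixed products, unitarity\<close>

lemma kronecker_carrier:
  assumes "A \<in> carrier_mat n m" "B \<in> carrier_mat k l"
  shows "kronecker A B \<in> carrier_mat (n * k) (m * l)"
  using assms by (auto simp: kronecker_def)

lemma kronecker_index:
  assumes "A \<in> carrier_mat n m" "B \<in> carrier_mat k l" "i < n * k" "j < m * l"
  shows "kronecker A B $$ (i, j) = A $$ (i div k, j div l) * B $$ (i mod k, j mod l)"
  using assms by (auto simp: kronecker_def)

lemma div_mod_less:
  fixes i n k :: nat
  assumes "i < n * k"
  shows "i div k < n" "i mod k < k"
proof -
  show "i div k < n" using assms by (simp add: less_mult_imp_div_less)
  show "i mod k < k" using assms by (cases k) auto
qed

text \<open>The mixed product rule: once the summation index is split into a pair, the double sum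
  factors into a product of two sums.\<close>

lemma kronecker_mult:
  fixes A B C D :: "'a :: comm_semiring_0 mat"
  assumes A: "A \<in> carrier_mat n m" and B: "B \<in> carrier_mat k l"
    and C: "C \<in> carrier_mat m p" and D: "D \<in> carrier_mat l q"
  shows "kronecker A B * kronecker C D = kronecker (A * C) (B * D)"
proof (rule eq_matI)
  note AB = kronecker_carrier[OF A B] and CD = kronecker_carrier[OF C D]
  note AC = mult_carrier_mat[OF A C] and BD = mult_carrier_mat[OF B D]
  note K = kronecker_carrier[OF AC BD]
  show "dim_row (kronecker A B * kronecker C D) = dim_row (kronecker (A * C) (B * D))"
    "dim_col (kronecker A B * kronecker C D) = dim_col (kronecker (A * C) (B * D))"
    using AB CD K by auto
  fix i j assume "i < dim_row (kronecker (A * C) (B * D))" "j < dim_col (kronecker (A * C) (B * D))"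
  then have ij: "i < n * k" "j < p * q" using K by auto
  note di = div_mod_less[OF ij(1)] and dj = div_mod_less[OF ij(2)]
  have "(kronecker A B * kronecker C D) $$ (i, j) =
      (\<Sum>r<m * l. A $$ (i div k, r div l) * B $$ (i mod k, r mod l) *
        (C $$ (r div l, j div q) * D $$ (r mod l, j mod q)))"
    unfolding mat_mult_index_sum[OF AB CD ij] using ij
    by (intro sum.cong refl) (simp add: kronecker_index[OF A B] kronecker_index[OF C D])
  also have "\<dots> = (\<Sum>r<m. \<Sum>s<l. A $$ (i div k, r) * B $$ (i mod k, s) *
        (C $$ (r, j div q) * D $$ (s, j mod q)))"
    by (rule sum_div_mod)
  also have "\<dots> = (A * C) $$ (i div k, j div q) * (B * D) $$ (i mod k, j mod q)"
    unfolding mat_mult_index_sum[OF A C di(1) dj(1)] mat_mult_index_sum[OF B D di(2) dj(2)]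
      sum_product
    by (simp add: mult_ac)
  also have "\<dots> = kronecker (A * C) (B * D) $$ (i, j)"
    by (rule kronecker_index[OF AC BD ij, symmetric])
  finally show "(kronecker A B * kronecker C D) $$ (i, j) = kronecker (A * C) (B * D) $$ (i, j)" .
qed

lemma kronecker_one: "kronecker (1\<^sub>m n) (1\<^sub>m k) = (1\<^sub>m (n * k) :: 'a :: semiring_1 mat)"
proof (rule eq_matI)
  fix i j assume "i < dim_row (1\<^sub>m (n * k) :: 'a mat)" "j < dim_col (1\<^sub>m (n * k) :: 'a mat)"
  then have ij: "i < n * k" "j < n * k" by auto
  have "i = j" if "i div k = j div k" "i mod k = j mod k" using that by (metis div_mult_mod_eq)
  then show "kronecker (1\<^sub>m n) (1\<^sub>m k) $$ (i, j) = (1\<^sub>m (n * k) :: 'a mat) $$ (i, j)"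
    using ij div_mod_less[OF ij(1)] div_mod_less[OF ij(2)]
    by (auto simp: kronecker_index[of _ n n _ k k])
qed (auto simp: kronecker_def)

lemma mat_adjoint_kronecker:
  fixes A B :: "complex mat"
  assumes A: "A \<in> carrier_mat n m" and B: "B \<in> carrier_mat k l"
  shows "mat_adjoint (kronecker A B) = kronecker (mat_adjoint A) (mat_adjoint B)"
proof (rule eq_matI)
  note c = mat_adjoint_carrier[OF A] mat_adjoint_carrier[OF B]
  note K = kronecker_carrier[OF A B] kronecker_carrier[OF c]
  note K' = mat_adjoint_carrier[OF K(1)]
  show "dim_row (mat_adjoint (kronecker A B)) = dim_row (kronecker (mat_adjoint A) (mat_adjoint B))"
    "dim_col (mat_adjoint (kronecker A B)) = dim_col (kronecker (mat_adjoint A) (mat_adjoint B))"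
    using K K' by auto
  fix i j assume "i < dim_row (kronecker (mat_adjoint A) (mat_adjoint B))"
    "j < dim_col (kronecker (mat_adjoint A) (mat_adjoint B))"
  then have ij: "i < m * l" "j < n * k" using K by auto
  then show "mat_adjoint (kronecker A B) $$ (i, j) = kronecker (mat_adjoint A) (mat_adjoint B) $$ (i, j)"
    using div_mod_less[OF ij(1)] div_mod_less[OF ij(2)]
    by (simp add: kronecker_index[OF c] mat_adjoint_index_complex[OF A] mat_adjoint_index_complex[OF B]
        mat_adjoint_index_complex[OF K(1)] kronecker_index[OF A B])
qed

lemma unitary_mat_kronecker:
  assumes U: "unitary_mat n U" and V: "unitary_mat k V"
  shows "unitary_mat (n * k) (kronecker U V)"
  unfolding unitary_mat_def
  using kronecker_carrier[OF unitary_matD(1)[OF U] unitary_matD(1)[OF V]]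
  by (simp add: mat_adjoint_kronecker[OF unitary_matD(1)[OF U] unitary_matD(1)[OF V]]
      kronecker_mult[OF unitary_matD(2)[OF U] unitary_matD(2)[OF V] unitary_matD(1)[OF U] unitary_matD(1)[OF V]]
      unitary_matD(3)[OF U] unitary_matD(3)[OF V] kronecker_one)

text \<open>Each identity has the size of the other factor, so for 4 by 4 factors this is the matrix
  \<open>X\<close> of the theorem.\<close>

definition kron_sum :: "complex mat \<Rightarrow> complex mat \<Rightarrow> complex mat" where
  "kron_sum A B = kronecker A (1\<^sub>m (dim_row B)) + kronecker (1\<^sub>m (dim_row A)) B"

lemma kron_sum_carrier:
  assumes "A \<in> carrier_mat n n" "B \<in> carrier_mat k k"
  shows "kron_sum A B \<in> carrier_mat (n * k) (n * k)"
  using assms unfolding kron_sum_def by (auto intro!: add_carrier_mat kronecker_carrier)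

lemma kron_sum_index:
  assumes A: "A \<in> carrier_mat n n" and B: "B \<in> carrier_mat k k" and ij: "i < n * k" "j < n * k"
  shows "kron_sum A B $$ (i, j) =
    (if i mod k = j mod k then A $$ (i div k, j div k) else 0) +
    (if i div k = j div k then B $$ (i mod k, j mod k) else 0)"
proof -
  have d: "dim_row A = n" "dim_row B = k" using A B by auto
  have c: "kronecker (1\<^sub>m n) B \<in> carrier_mat (n * k) (n * k)"
    by (rule kronecker_carrier) (use B in auto)
  show ?thesis
    unfolding kron_sum_def d using ij c div_mod_less[OF ij(1)] div_mod_less[OF ij(2)]
    by (simp add: kronecker_index[OF A one_carrier_mat] kronecker_index[OF one_carrier_mat B])
qed

text \<open>By the mixed product rule, the two summands can be conjugated separately, which allows
  an independent change of basis in each tensor factor.\<close>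

lemma kron_sum_conj:
  assumes A: "A \<in> carrier_mat n n" "A' \<in> carrier_mat n n"
    and B: "B \<in> carrier_mat k k" "B' \<in> carrier_mat k k"
    and U: "U \<in> carrier_mat n n" and V: "V \<in> carrier_mat k k"
    and AU: "A * U = U * A'" and BV: "B * V = V * B'"
  shows "kron_sum A B * kronecker U V = kronecker U V * kron_sum A' B'"
proof -
  have d: "dim_row A = n" "dim_row A' = n" "dim_row B = k" "dim_row B' = k" using A B by auto
  note one = one_carrier_mat[where 'a = complex]
  note c = kronecker_carrier[OF U V] kronecker_carrier[OF A(1) one] kronecker_carrier[OF one B(1)]
    kronecker_carrier[OF A(2) one] kronecker_carrier[OF one B(2)]
  show ?thesis
    unfolding kron_sum_def d using U V AU BV
    by (simp add: add_mult_distrib_mat[OF c(2,3,1)] mult_add_distrib_mat[OF c(1,4,5)]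
        kronecker_mult[OF A(1) one U V] kronecker_mult[OF one B(1) U V]
        kronecker_mult[OF U V A(2) one] kronecker_mult[OF U V one B(2)])
qed

text \<open>The permutation matrix that flips the two tensor factors is unitary and intertwines the
  two Kronecker sums.\<close>

lemma kron_sum_swap:
  assumes A: "A \<in> carrier_mat n n" and B: "B \<in> carrier_mat k k"
  shows "\<exists>P. unitary_mat (n * k) P \<and> kron_sum A B * P = P * kron_sum B A"
proof -
  \<comment> \<open>With \<open>i < n\<close> and \<open>j < k\<close>, \<open>f\<close> sends
    \<open>i * k + j\<close> to \<open>j * n + i\<close>, and \<open>g\<close> is its inverse.
    Column \<open>j\<close> of \<open>P\<close> has its entry 1 in row \<open>g j\<close>.\<close>
  define f where "f r = (r mod k) * n + r div k" for r
  define g where "g r = (r mod n) * k + r div n" for r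
  define P where "P = mat (n * k) (n * k) (\<lambda>(i, j). if i = g j then 1 else 0 :: complex)"
  have f: "f r < n * k" "f r div n = r mod k" "f r mod n = r div k" "g (f r) = r"
    if r: "r < n * k" for r
  proof -
    note d = div_mod_less[OF r]
    have "f r < Suc (r mod k) * n" using d unfolding f_def by simp
    also have "\<dots> \<le> k * n" using d by (intro mult_le_mono1) auto
    finally show "f r < n * k" by (simp add: mult.commute)
    show "f r div n = r mod k" "f r mod n = r div k" using d unfolding f_def by auto
    then show "g (f r) = r" unfolding g_def by simp
  qed
  have g: "g r < n * k" "g r div k = r mod n" "g r mod k = r div n" "f (g r) = r"
    if "r < n * k" for r
  proof -
    from that have r: "r < k * n" by (simp add: mult.commute)
    note d = div_mod_less[OF r]
    have "g r < Suc (r mod n) * k" using d unfolding g_def by simp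
    also have "\<dots> \<le> n * k" using d by (intro mult_le_mono1) auto
    finally show "g r < n * k" .
    show "g r div k = r mod n" "g r mod k = r div n" using d unfolding g_def by auto
    then show "f (g r) = r" unfolding f_def by simp
  qed
  have P: "P \<in> carrier_mat (n * k) (n * k)" by (simp add: P_def)
  have P_index: "P $$ (i, j) = (if i = g j then 1 else 0)" if "i < n * k" "j < n * k" for i j
    using that by (simp add: P_def)
  have "unitary_mat (n * k) P"
  proof (rule unitary_matI_index[OF P])
    fix i j assume ij: "i < n * k" "j < n * k"
    have "(\<Sum>r<n * k. cnj (P $$ (r, i)) * P $$ (r, j)) =
        (\<Sum>r<n * k. if r = g i then (if g i = g j then 1 else 0) else 0)"
      using ij by (intro sum.cong) (auto simp: P_index)
    also have "\<dots> = (if g i = g j then 1 else 0)" using g(1)[OF ij(1)] by simp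
    also have "(g i = g j) = (i = j)" using g(4)[OF ij(1)] g(4)[OF ij(2)] by metis
    finally show "(\<Sum>r<n * k. cnj (P $$ (r, i)) * P $$ (r, j)) = (if i = j then 1 else 0)" .
  qed
  moreover have "kron_sum A B * P = P * kron_sum B A"
  proof (rule eq_matI)
    note AB = kron_sum_carrier[OF A B]
    have BA: "kron_sum B A \<in> carrier_mat (n * k) (n * k)"
      using kron_sum_carrier[OF B A] by (simp add: mult.commute)
    show "dim_row (kron_sum A B * P) = dim_row (P * kron_sum B A)"
      "dim_col (kron_sum A B * P) = dim_col (P * kron_sum B A)" using AB BA P by auto
    fix i j assume "i < dim_row (P * kron_sum B A)" "j < dim_col (P * kron_sum B A)"
    then have ij: "i < n * k" "j < n * k" using BA P by auto
    then have ij': "i < k * n" "j < k * n" by (simp_all add: mult.commute)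
    \<comment> \<open>Multiplication by \<open>P\<close> from the right selects column
      \<open>g j\<close>; from the left, below, it selects row \<open>f i\<close>.\<close>
    have "(kron_sum A B * P) $$ (i, j) = (\<Sum>r<n * k. if r = g j then kron_sum A B $$ (i, g j) else 0)"
      unfolding mat_mult_index_sum[OF AB P ij] using ij by (intro sum.cong) (auto simp: P_index)
    also have "\<dots> = kron_sum A B $$ (i, g j)" using g[OF ij(2)] by simp
    also have "\<dots> = kron_sum B A $$ (f i, j)"
      using ij ij' f[OF ij(1)] g[OF ij(2)]
      by (simp add: kron_sum_index[OF A B] kron_sum_index[OF B A] mult.commute[of k n])
    also have "\<dots> = (\<Sum>r<n * k. if r = f i then kron_sum B A $$ (f i, j) else 0)"
      using f[OF ij(1)] by simp
    also have "\<dots> = (P * kron_sum B A) $$ (i, j)"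
      unfolding mat_mult_index_sum[OF P BA ij]
    proof (intro sum.cong refl)
      fix r assume "r \<in> {..<n * k}"
      then have r: "r < n * k" by simp
      have "(i = g r) = (r = f i)" using f(4)[OF ij(1)] g(4)[OF r] by metis
      then show "(if r = f i then kron_sum B A $$ (f i, j) else 0) = P $$ (i, r) * kron_sum B A $$ (r, j)"
        using ij r by (simp add: P_index)
    qed
    finally show "(kron_sum A B * P) $$ (i, j) = (P * kron_sum B A) $$ (i, j)" .
  qed
  ultimately show ?thesis by blast
qed

subsection \<open>Singular values of block diagonal matrices\<close>

text \<open>For a symmetric relation, \<open>sorted_wrt\<close> says that it holds between entries
  at any two different positions, and this does not depend on the order. So eigenvalues may be
  listed in any convenient order.\<close>

lemma sorted_wrt_mset_cong:
  assumes sym: "\<And>x y. P x y \<Longrightarrow> P y x"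
    and "sorted_wrt P xs" "mset xs = mset ys"
  shows "sorted_wrt P ys"
  using assms(2,3)
proof (induction xs arbitrary: ys)
  case (Cons x xs)
  have "x \<in> set ys" using Cons.prems(2) by (metis list.set_intros(1) set_mset_mset)
  then obtain as bs where ys: "ys = as @ x # bs" by (meson split_list)
  with Cons.prems(2) have eq: "mset xs = mset (as @ bs)" by simp
  then have "sorted_wrt P (as @ bs)" using Cons by auto
  moreover have "set xs = set as \<union> set bs" using eq by (metis set_append set_mset_mset)
  ultimately show ?case using Cons.prems(1) sym unfolding ys by (auto simp: sorted_wrt_append)
qed auto

lemma sorted_wrt_concat:
  assumes "\<And>xs. xs \<in> set xss \<Longrightarrow> sorted_wrt P xs"
    and "sorted_wrt (\<lambda>xs ys. \<forall>x\<in>set xs. \<forall>y\<in>set ys. P x y) xss"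
  shows "sorted_wrt P (concat xss)"
  using assms by (induction xss) (auto simp: sorted_wrt_append)

lemma proots_linear_factors:
  "proots (\<Prod>c\<leftarrow>cs. [:- c, 1:]) = mset (cs :: 'a :: idom list)"
proof (induction cs)
  case (Cons c cs)
  have "(\<Prod>c\<leftarrow>cs. [:- c, 1:]) \<noteq> 0" by (auto simp: prod_list_zero_iff)
  then show ?case using Cons by (simp add: proots_mult del: mult_pCons_left)
qed simp

text \<open>Here \<open>sorted_wrt\<close> expresses a bound for all pairs of roots, with
  multiplicity, and not an ordering. The roots are nonnegative, so squaring the singular values
  gives them back.\<close>

lemma sorted_wrt_singular_values:
  assumes X: "X \<in> carrier_mat n n"
    and cp: "char_poly (mat_adjoint X * X) = (\<Prod>c\<leftarrow>cs. [:- c, 1:])"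
    and cs: "sorted_wrt (\<lambda>c d. Re c + Re d \<le> K) cs"
  shows "sorted_wrt (\<lambda>s t. s\<^sup>2 + t\<^sup>2 \<le> K) (singular_values X)"
proof (rule sorted_wrt_mset_cong)
  have "poly (char_poly (mat_adjoint X * X)) c = 0" if "c \<in> set cs" for c
    using that unfolding cp poly_prod_list by (auto simp: prod_list_zero_iff)
  then have "Re c \<ge> 0" if "c \<in> set cs" for c
    using char_poly_gram_root_nonneg(2)[OF X] that by blast
  then show "sorted_wrt (\<lambda>s t. s\<^sup>2 + t\<^sup>2 \<le> K) (map (\<lambda>c. sqrt (Re c)) cs)"
    using cs unfolding sorted_wrt_map by (rule_tac sorted_wrt_mono_rel[rotated]) auto
  show "mset (map (\<lambda>c. sqrt (Re c)) cs) = mset (singular_values X)"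
    unfolding singular_values_def cp proots_linear_factors by simp
qed (simp add: add.commute)

corollary singular_values_top_two:
  assumes X: "X \<in> carrier_mat n n" and n: "2 \<le> n"
    and cp: "char_poly (mat_adjoint X * X) = (\<Prod>c\<leftarrow>cs. [:- c, 1:])"
    and cs: "sorted_wrt (\<lambda>c d. Re c + Re d \<le> K) cs"
  shows "(singular_values X ! 0)\<^sup>2 + (singular_values X ! 1)\<^sup>2 \<le> K"
  using sorted_wrt_nth_less[OF sorted_wrt_singular_values[OF X cp cs], of 0 1]
    length_singular_values[OF X] n by simp

lemma singular_values_unitary_equiv:
  assumes "X \<in> carrier_mat n n" "Y \<in> carrier_mat n n" "unitary_mat n U" "X * U = U * Y"
  shows "singular_values X = singular_values Y"
  unfolding singular_values_def char_poly_similar[OF gram_eq_conj[OF assms]] ..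

section \<open>Upper bounds and sums for the roots of a Gram matrix\<close>

lemma mult_mat_vec_index_sum:
  assumes "A \<in> carrier_mat n m" "v \<in> carrier_vec m" "i < n"
  shows "(A *\<^sub>v v) $ i = (\<Sum>j<m. A $$ (i, j) * v $ j)"
  using assms by (auto simp: scalar_prod_def atLeast0LessThan intro!: sum.cong)

text \<open>A Rayleigh quotient argument: for an eigenvector \<open>u\<close> with eigenvalue
  \<open>z\<close>, the squared norm of \<open>M *\<^sub>v u\<close> is \<open>z\<close> times that
  of \<open>u\<close>. Vectors enter the bound as functions, so that applications only estimate
  finite sums.\<close>

lemma gram_root_le:
  assumes M: "M \<in> carrier_mat n m"
    and root: "poly (char_poly (mat_adjoint M * M)) z = 0"
    and le: "\<And>v. (\<Sum>i<n. (cmod (\<Sum>j<m. M $$ (i, j) * v j))\<^sup>2) \<le> K * (\<Sum>j<m. (cmod (v j))\<^sup>2)"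
  shows "Re z \<le> K"
proof -
  let ?G = "mat_adjoint M * M"
  note M' = mat_adjoint_carrier[OF M]
  have G: "?G \<in> carrier_mat m m" using M M' by auto
  from root obtain u where "eigenvector ?G u z"
    using eigenvalue_root_char_poly[OF G] unfolding eigenvalue_def by blast
  then have u: "u \<in> carrier_vec m" "u \<noteq> 0\<^sub>v m" "?G *\<^sub>v u = z \<cdot>\<^sub>v u"
    using G unfolding eigenvector_def by auto
  define v where "v j = u $ j" for j
  define w where "w i = (\<Sum>j<m. M $$ (i, j) * v j)" for i
  define s where "s = (\<Sum>j<m. (cmod (v j))\<^sup>2)"
  have row: "(\<Sum>k<m. ?G $$ (j, k) * v k) = z * v j" if j: "j < m" for j
  proof -
    have "(\<Sum>k<m. ?G $$ (j, k) * v k) = (?G *\<^sub>v u) $ j"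
      unfolding mult_mat_vec_index_sum[OF G u(1) j] v_def ..
    also have "\<dots> = z * v j" unfolding u(3) using j u(1) by (simp add: v_def)
    finally show ?thesis .
  qed
  \<comment> \<open>The quadratic form of the Gram matrix is expanded into a triple sum and
    regrouped by the rows of \<open>M\<close>.\<close>
  have "z * of_real s = (\<Sum>j<m. cnj (v j) * (z * v j))"
    unfolding s_def of_real_sum sum_distrib_left
    by (intro sum.cong) (simp_all add: complex_norm_square mult_ac del: of_real_power)
  also have "\<dots> = (\<Sum>j<m. \<Sum>k<m. \<Sum>i<n. cnj (v j) * (cnj (M $$ (i, j)) * M $$ (i, k) * v k))"
    by (simp add: gram_index[OF M] sum_distrib_left sum_distrib_right flip: row del: index_mult_mat(1))
  also have "\<dots> = (\<Sum>j<m. \<Sum>i<n. \<Sum>k<m. cnj (v j) * (cnj (M $$ (i, j)) * M $$ (i, k) * v k))"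
    by (intro sum.cong refl sum.swap)
  also have "\<dots> = (\<Sum>i<n. \<Sum>j<m. \<Sum>k<m. cnj (v j) * (cnj (M $$ (i, j)) * M $$ (i, k) * v k))"
    by (rule sum.swap)
  also have "\<dots> = (\<Sum>i<n. cnj (w i) * w i)"
    unfolding w_def cnj_sum sum_product by (simp add: mult_ac)
  also have "\<dots> = of_real (\<Sum>i<n. (cmod (w i))\<^sup>2)"
    unfolding of_real_sum by (simp add: complex_norm_square mult.commute del: of_real_power)
  finally have "z * of_real s = of_real (\<Sum>i<n. (cmod (w i))\<^sup>2)" .
  from arg_cong[OF this, of Re] have "Re z * s = (\<Sum>i<n. (cmod (w i))\<^sup>2)" by simp
  then have "Re z * s \<le> K * s" using le[of v] unfolding w_def s_def by simp
  moreover have "s > 0"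
  proof -
    obtain j where j: "j < m" "v j \<noteq> 0" using u(1,2) unfolding v_def by (metis eq_vecI carrier_vecD index_zero_vec)
    then have "0 < (cmod (v j))\<^sup>2" by simp
    also have "\<dots> \<le> s" unfolding s_def using j(1) by (intro member_le_sum) auto
    finally show ?thesis .
  qed
  ultimately show ?thesis by simp
qed

text \<open>A Schur decomposition has the roots on its diagonal, and the trace is invariant under
  similarity.\<close>

lemma sum_roots_char_poly:
  fixes G :: "complex mat"
  assumes G: "G \<in> carrier_mat n n" and cp: "char_poly G = (\<Prod>c\<leftarrow>cs. [:- c, 1:])"
  shows "sum_list cs = mat_trace G"
proof -
  obtain B P Q where "schur_decomposition G cs = (B, P, Q)" by (metis prod_cases3)
  from schur_decomposition[OF G cp this] have *: "similar_mat G B" "diag_mat B = cs"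
    unfolding similar_mat_def by auto
  have "mat_trace B = sum_list (diag_mat B)"
    unfolding mat_trace_def diag_mat_def by (simp add: interv_sum_list_conv_sum_set_nat atLeast0LessThan)
  then show ?thesis using mat_trace_similar[OF *(1)] *(2) by simp
qed

section \<open>Block diagonal matrices\<close>

definition diag_blk :: "nat \<Rightarrow> 'a mat \<Rightarrow> nat \<Rightarrow> 'a mat" where
  "diag_blk m G i = mat m m (\<lambda>(r, s). G $$ (i * m + r, i * m + s))"

lemma diag_blk_carrier [simp]: "diag_blk m G i \<in> carrier_mat m m"
  by (simp add: diag_blk_def)

lemma block_index_less:
  fixes i k m r :: nat
  assumes "i < k" "r < m"
  shows "i * m + r < k * m"
proof -
  have "i * m + r < Suc i * m" using assms by simp
  also have "\<dots> \<le> k * m" using assms by (intro mult_le_mono1) auto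
  finally show ?thesis .
qed

text \<open>Induction on the number of blocks: with the last block split off, the lower left corner
  is 0, and the characteristic polynomial of a block triangular matrix is a product.\<close>

lemma char_poly_block_diag:
  fixes G :: "complex mat"
  assumes "G \<in> carrier_mat (k * m) (k * m)"
    and "\<And>p q. p < k * m \<Longrightarrow> q < k * m \<Longrightarrow> p div m \<noteq> q div m \<Longrightarrow> G $$ (p, q) = 0"
  shows "char_poly G = (\<Prod>i\<leftarrow>[0..<k]. char_poly (diag_blk m G i))"
  using assms
proof (induction k arbitrary: G)
  case 0
  then show ?case using degree_monic_char_poly[of G 0] by (auto intro: monic_degree_0[THEN iffD1])
next
  case (Suc k)
  note G = Suc.prems(1)
  define H where "H = mat (k * m) (k * m) (\<lambda>ij. G $$ ij)"
  define C where "C = mat (k * m) m (\<lambda>(i, j). G $$ (i, k * m + j))"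
  have H: "H \<in> carrier_mat (k * m) (k * m)" by (simp add: H_def)
  have C: "C \<in> carrier_mat (k * m) m" by (simp add: C_def)
  have "G = four_block_mat H C (0\<^sub>m m (k * m)) (diag_blk m G k)"
  proof (rule eq_matI)
    fix i j assume "i < dim_row (four_block_mat H C (0\<^sub>m m (k * m)) (diag_blk m G k))"
      "j < dim_col (four_block_mat H C (0\<^sub>m m (k * m)) (diag_blk m G k))"
    then have ij: "i < k * m + m" "j < k * m + m" using H by (auto simp: diag_blk_def)
    have "G $$ (i, j) = 0" if "\<not> i < k * m" "j < k * m"
    proof (rule Suc.prems(2))
      have "j div m < k" using that by (simp add: less_mult_imp_div_less)
      moreover have "k \<le> i div m" using that ij
        by (metis div_le_mono linorder_not_less mult_0_right nonzero_mult_div_cancel_right less_nat_zero_code)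
      ultimately show "i div m \<noteq> j div m" by simp
    qed (use ij in auto)
    then show "G $$ (i, j) = four_block_mat H C (0\<^sub>m m (k * m)) (diag_blk m G k) $$ (i, j)"
      using ij H C by (auto simp: H_def C_def diag_blk_def)
  qed (use G in \<open>auto simp: H_def diag_blk_def\<close>)
  then have "char_poly G = char_poly H * char_poly (diag_blk m G k)"
    by (rule char_poly_0_block)
       (use H C char_poly_factorized[OF H] char_poly_factorized[OF diag_blk_carrier[of m G k]] in auto)
  also have "char_poly H = (\<Prod>i\<leftarrow>[0..<k]. char_poly (diag_blk m H i))"
    by (rule Suc.IH[OF H]) (use Suc.prems(2) in \<open>auto simp: H_def\<close>)
  also have "\<dots> = (\<Prod>i\<leftarrow>[0..<k]. char_poly (diag_blk m G i))"
  proof (intro arg_cong[of _ _ prod_list] map_cong refl arg_cong[of _ _ char_poly])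
    fix i assume "i \<in> set [0..<k]"
    then show "diag_blk m H i = diag_blk m G i"
      unfolding diag_blk_def by (intro eq_matI) (auto simp: H_def block_index_less)
  qed
  finally show ?case by simp
qed

text \<open>A row meets nonzero entries only in the columns of its own block. So columns from
  different blocks are orthogonal, and the inner product of two columns of one block is a sum over
  the rows of that block.\<close>

lemma
  fixes X :: "complex mat"
  assumes X: "X \<in> carrier_mat (k * m) (k * m)"
    and off: "\<And>p q. p < k * m \<Longrightarrow> q < k * m \<Longrightarrow> p div m \<noteq> q div m \<Longrightarrow> X $$ (p, q) = 0"
  shows gram_off_block: "\<And>p q. p < k * m \<Longrightarrow> q < k * m \<Longrightarrow> p div m \<noteq> q div m \<Longrightarrow>
      (mat_adjoint X * X) $$ (p, q) = 0"
    and diag_blk_gram: "\<And>i. i < k \<Longrightarrow>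
      diag_blk m (mat_adjoint X * X) i = mat_adjoint (diag_blk m X i) * diag_blk m X i"
proof -
  fix p q assume pq: "p < k * m" "q < k * m" "p div m \<noteq> q div m"
  have "cnj (X $$ (r, p)) * X $$ (r, q) = 0" if "r < k * m" for r
    using off[OF that pq(1)] off[OF that pq(2)] pq(3) by fastforce
  then show "(mat_adjoint X * X) $$ (p, q) = 0" unfolding gram_index[OF X pq(1,2)] by (intro sum.neutral) auto
next
  fix i assume i: "i < k"
  have M: "diag_blk m X i \<in> carrier_mat m m" by simp
  show "diag_blk m (mat_adjoint X * X) i = mat_adjoint (diag_blk m X i) * diag_blk m X i"
  proof (rule eq_matI)
    fix a b assume "a < dim_row (mat_adjoint (diag_blk m X i) * diag_blk m X i)"
      "b < dim_col (mat_adjoint (diag_blk m X i) * diag_blk m X i)"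
    then have ab: "a < m" "b < m" using mat_adjoint_carrier[OF M] M by (auto simp del: diag_blk_carrier)
    define f where "f i' r = cnj (X $$ (i' * m + r, i * m + a)) * X $$ (i' * m + r, i * m + b)" for i' r
    note less = block_index_less[OF i ab(1)] block_index_less[OF i ab(2)]
    have "diag_blk m (mat_adjoint X * X) i $$ (a, b) = (\<Sum>r<k * m. f (r div m) (r mod m))"
      using ab by (simp add: diag_blk_def gram_index[OF X less] f_def del: index_mult_mat(1))
    also have "\<dots> = (\<Sum>i'<k. \<Sum>r<m. f i' r)" by (rule sum_div_mod)
    also have "\<dots> = (\<Sum>i'<k. if i' = i then \<Sum>r<m. f i r else 0)"
    proof (intro sum.cong refl)
      fix i' assume "i' \<in> {..<k}"
      then have "f i' r = 0" if "r < m" "i' \<noteq> i" for r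
        using off[OF block_index_less[of i' k r m] less(1)] that ab unfolding f_def by simp
      then show "(\<Sum>r<m. f i' r) = (if i' = i then \<Sum>r<m. f i r else 0)" by simp
    qed
    also have "\<dots> = (\<Sum>r<m. f i r)" using i by simp
    also have "\<dots> = (mat_adjoint (diag_blk m X i) * diag_blk m X i) $$ (a, b)"
      unfolding gram_index[OF M ab] using ab by (intro sum.cong) (auto simp: f_def diag_blk_def)
    finally show "diag_blk m (mat_adjoint X * X) i $$ (a, b) =
      (mat_adjoint (diag_blk m X i) * diag_blk m X i) $$ (a, b)" .
  qed (use mat_adjoint_carrier[OF M] in \<open>auto simp: diag_blk_def\<close>)
qed

subsection \<open>Norm estimates\<close>

text \<open>After multiplication by \<open>x\<^sup>2 + y\<^sup>2\<close>, the difference of the two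
  sides is a sum of squares. The constant 4/3 is the one of \<open>sum_zero_single\<close>.\<close>

lemma equal_diagonal_bound_real:
  fixes A B C x y :: real
  shows "(A * x + B * y)\<^sup>2 + (C * x + A * y)\<^sup>2 \<le> (4 / 3 * A\<^sup>2 + 2 * (B\<^sup>2 + C\<^sup>2)) * (x\<^sup>2 + y\<^sup>2)"
proof (cases "x\<^sup>2 + y\<^sup>2 = 0")
  case False
  define s where "s = x\<^sup>2 + y\<^sup>2"
  have s: "s > 0" using False unfolding s_def by (simp add: add_nonneg_nonneg order_less_le)
  have "s * ((4 / 3 * A\<^sup>2 + 2 * (B\<^sup>2 + C\<^sup>2)) * s - ((A * x + B * y)\<^sup>2 + (C * x + A * y)\<^sup>2)) =
      1 / 3 * (A * s - 3 * x * y * (B + C))\<^sup>2 + 2 * (B * x\<^sup>2 - C * y\<^sup>2)\<^sup>2 + (B * y\<^sup>2 - C * x\<^sup>2)\<^sup>2"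
    unfolding s_def by (simp add: power2_eq_square field_simps)
  also have "\<dots> \<ge> 0" by simp
  finally show ?thesis using s unfolding s_def by (simp add: zero_le_mult_iff)
qed simp

text \<open>The triangle inequality reduces the estimate for the block [[a, b], [c, a]] to the
  moduli.\<close>

lemma equal_diagonal_bound:
  fixes a b c x y :: complex
  shows "(cmod (a * x + b * y))\<^sup>2 + (cmod (c * x + a * y))\<^sup>2 \<le>
    (4 / 3 * (cmod a)\<^sup>2 + 2 * ((cmod b)\<^sup>2 + (cmod c)\<^sup>2)) * ((cmod x)\<^sup>2 + (cmod y)\<^sup>2)"
proof -
  have "(cmod (a * x + b * y))\<^sup>2 + (cmod (c * x + a * y))\<^sup>2 \<le>
      (cmod a * cmod x + cmod b * cmod y)\<^sup>2 + (cmod c * cmod x + cmod a * cmod y)\<^sup>2"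
    by (intro add_mono power_mono norm_ge_zero order_trans[OF norm_triangle_ineq]) (simp_all add: norm_mult)
  also note equal_diagonal_bound_real
  finally show ?thesis .
qed

lemma cmod_Cauchy_Schwarz2:
  fixes a b x y :: complex
  shows "(cmod (a * x + b * y))\<^sup>2 \<le> ((cmod a)\<^sup>2 + (cmod b)\<^sup>2) * ((cmod x)\<^sup>2 + (cmod y)\<^sup>2)"
proof -
  have "(cmod (a * x + b * y))\<^sup>2 \<le> (cmod a * cmod x + cmod b * cmod y)\<^sup>2"
    by (intro power_mono norm_ge_zero order_trans[OF norm_triangle_ineq]) (simp add: norm_mult)
  \<comment> \<open>The added square is the defect in Lagrange's identity.\<close>
  also have "\<dots> \<le> \<dots> + (cmod a * cmod y - cmod b * cmod x)\<^sup>2" by simp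
  also have "\<dots> = ((cmod a)\<^sup>2 + (cmod b)\<^sup>2) * ((cmod x)\<^sup>2 + (cmod y)\<^sup>2)"
    by (simp add: power2_eq_square algebra_simps)
  finally show ?thesis .
qed

section \<open>Inequalities for four complex numbers with sum zero\<close>

lemma sum_lessThan_2: "(\<Sum>i<2. f i) = f 0 + f (1 :: nat)"
  by (simp add: numeral_2_eq_2)

lemma sum_lessThan_4: "(\<Sum>i<4. f i) = f 0 + f 1 + f 2 + f (3 :: nat)"
  by (simp add: eval_nat_numeral add.assoc)

lemma less_4_cases: "(i :: nat) < 4 \<Longrightarrow> i = 0 \<or> i = 1 \<or> i = 2 \<or> i = 3"
  by auto

lemma cmod_add_sq_le: "(cmod (x + y))\<^sup>2 \<le> 2 * ((cmod x)\<^sup>2 + (cmod y)\<^sup>2)"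
  using cmod_Cauchy_Schwarz2[of 1 x 1 y] by simp

text \<open>The sum \<open>x + y\<close> has the same modulus as \<open>z + w\<close>, whose square
  is at most twice the sum of the two squares.\<close>

lemma four_sum_zero_pair:
  fixes x y z w :: complex
  assumes "x + y + z + w = 0"
  shows "(cmod x)\<^sup>2 + (cmod y)\<^sup>2 + (cmod (x + y))\<^sup>2 / 2 \<le>
    (cmod x)\<^sup>2 + (cmod y)\<^sup>2 + (cmod z)\<^sup>2 + (cmod w)\<^sup>2"
proof -
  have "x + y = - (z + w)" using assms by (metis add.assoc eq_neg_iff_add_eq_0)
  then have "cmod (x + y) = cmod (z + w)" by (metis norm_minus_cancel)
  then show ?thesis using cmod_add_sq_le[of z w] by simp
qed

lemma sum_zero_pair:
  fixes a :: "nat \<Rightarrow> complex"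
  assumes "(\<Sum>i<4. a i) = 0" "i < 4" "j < 4" "i \<noteq> j"
  shows "(cmod (a i))\<^sup>2 + (cmod (a j))\<^sup>2 + (cmod (a i + a j))\<^sup>2 / 2 \<le> (\<Sum>i<4. (cmod (a i))\<^sup>2)"
proof -
  have 0: "a 0 + a 1 + a 2 + a 3 = 0" using assms(1) by (simp add: sum_lessThan_4)
  \<comment> \<open>One instance for each unordered pair of indices.\<close>
  note * = four_sum_zero_pair[of "a 0" "a 1" "a 2" "a 3"] four_sum_zero_pair[of "a 0" "a 2" "a 1" "a 3"]
    four_sum_zero_pair[of "a 0" "a 3" "a 1" "a 2"] four_sum_zero_pair[of "a 1" "a 2" "a 0" "a 3"]
    four_sum_zero_pair[of "a 1" "a 3" "a 0" "a 2"] four_sum_zero_pair[of "a 2" "a 3" "a 0" "a 1"]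
  from * 0 show ?thesis
    using less_4_cases[OF assms(2)] less_4_cases[OF assms(3)] assms(4)
    unfolding sum_lessThan_4 by (elim disjE; simp add: add_ac)
qed

text \<open>Equality holds when the other three numbers are all \<open>- a i / 3\<close>. The proof
  minimizes the bound of \<open>sum_zero_pair\<close> over the second number, with any index
  \<open>j\<close> different from \<open>i\<close>.\<close>

lemma sum_zero_single:
  fixes a :: "nat \<Rightarrow> complex"
  assumes a: "(\<Sum>i<4. a i) = 0" and i: "i < 4"
  shows "4 / 3 * (cmod (a i))\<^sup>2 \<le> (\<Sum>i<4. (cmod (a i))\<^sup>2)"
proof -
  define j where "j = (if i = 0 then 1 else 0 :: nat)"
  have tri: "4 / 3 * (cmod x)\<^sup>2 \<le> (cmod x)\<^sup>2 + (cmod y)\<^sup>2 + (cmod (x + y))\<^sup>2 / 2" for x y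
  proof -
    have "4 / 3 * x\<^sup>2 \<le> x\<^sup>2 + y\<^sup>2 + (x + y)\<^sup>2 / 2" for x y :: real
    proof -
      \<comment> \<open>Completing the square in \<open>y\<close>; the minimum is at
        \<open>y = - x / 3\<close>.\<close>
      have "x\<^sup>2 + y\<^sup>2 + (x + y)\<^sup>2 / 2 - 4 / 3 * x\<^sup>2 = (x + 3 * y)\<^sup>2 / 6"
        by (simp add: power2_eq_square field_simps)
      then show ?thesis using zero_le_power2[of "x + 3 * y"] by linarith
    qed
    from add_mono[OF this[of "Re x" "Re y"] this[of "Im x" "Im y"]]
    show ?thesis by (simp add: cmod_power2 field_simps)
  qed
  show ?thesis using order_trans[OF tri sum_zero_pair[OF a i, of j]] unfolding j_def by auto
qed

text \<open>The right side is twice the sum of the lower bounds from \<open>sum_zero_single\<close>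
  for \<open>a\<close> and from \<open>sum_zero_pair\<close> for \<open>b\<close> and
  \<open>c\<close>. A real sum of squares identity is applied to real and imaginary parts.\<close>

lemma diag_pair_same:
  fixes a b c :: complex
  shows "(cmod (a + b))\<^sup>2 + (cmod (a + c))\<^sup>2 \<le>
    8 / 3 * (cmod a)\<^sup>2 + 2 * ((cmod b)\<^sup>2 + (cmod c)\<^sup>2 + (cmod (b + c))\<^sup>2 / 2)"
proof -
  have "(a + b)\<^sup>2 + (a + c)\<^sup>2 \<le> 8 / 3 * a\<^sup>2 + 2 * (b\<^sup>2 + c\<^sup>2 + (b + c)\<^sup>2 / 2)" for a b c :: real
  proof -
    have "8 / 3 * a\<^sup>2 + 2 * (b\<^sup>2 + c\<^sup>2 + (b + c)\<^sup>2 / 2) - ((a + b)\<^sup>2 + (a + c)\<^sup>2) =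
        (2 * a - 3 * (b + c))\<^sup>2 / 6 + (b - c)\<^sup>2 / 2"
      by (simp add: power2_eq_square field_simps)
    also have "\<dots> \<ge> 0" by simp
    finally show ?thesis by simp
  qed
  from add_mono[OF this[of "Re a" "Re b" "Re c"] this[of "Im a" "Im b" "Im c"]]
  show ?thesis by (simp add: cmod_power2 field_simps)
qed

text \<open>If both indices differ, each square is at most twice the sum of two squares and no term
  is used twice. If one index is shared, \<open>diag_pair_same\<close> applies.\<close>

lemma diag_pair:
  fixes a b :: "nat \<Rightarrow> complex"
  assumes a: "(\<Sum>i<4. a i) = 0" and b: "(\<Sum>i<4. b i) = 0"
    and less: "i < 4" "j < 4" "k < 4" "l < 4" and ne: "i \<noteq> k \<or> j \<noteq> l"
  shows "(cmod (a i + b j))\<^sup>2 + (cmod (a k + b l))\<^sup>2 \<le>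
    2 * ((\<Sum>i<4. (cmod (a i))\<^sup>2) + (\<Sum>i<4. (cmod (b i))\<^sup>2))"
proof -
  consider "i \<noteq> k" "j \<noteq> l" | "i = k" "j \<noteq> l" | "i \<noteq> k" "j = l" using ne by blast
  then show ?thesis
  proof cases
    case 1
    have "(cmod (a i))\<^sup>2 + (cmod (a k))\<^sup>2 \<le> (\<Sum>i<4. (cmod (a i))\<^sup>2)"
      using sum_zero_pair[OF a less(1,3) 1(1)] zero_le_power2[of "cmod (a i + a k)"] by linarith
    moreover have "(cmod (b j))\<^sup>2 + (cmod (b l))\<^sup>2 \<le> (\<Sum>i<4. (cmod (b i))\<^sup>2)"
      using sum_zero_pair[OF b less(2,4) 1(2)] zero_le_power2[of "cmod (b j + b l)"] by linarith
    ultimately show ?thesis using cmod_add_sq_le[of "a i" "b j"] cmod_add_sq_le[of "a k" "b l"]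
      unfolding distrib_left by linarith
  next
    case 2
    with sum_zero_single[OF a less(1)] sum_zero_pair[OF b less(2,4) 2(2)]
      diag_pair_same[of "a i" "b j" "b l"]
    show ?thesis by simp
  next
    case 3
    with sum_zero_single[OF b less(2)] sum_zero_pair[OF a less(1,3) 3(1)]
      diag_pair_same[of "b j" "a i" "a k"]
    show ?thesis by (simp add: add.commute)
  qed
qed

text \<open>The squared Frobenius norm. As a trace it matches the hypothesis of the theorem and is
  visibly invariant under unitary conjugation; \<open>frob2_eq\<close> gives it through
  entries.\<close>

definition frob2 :: "complex mat \<Rightarrow> real" where
  "frob2 A = Re (mat_trace (mat_adjoint A * A))"

lemma frob2_eq: "A \<in> carrier_mat n m \<Longrightarrow> frob2 A = (\<Sum>j<m. \<Sum>i<n. (cmod (A $$ (i, j)))\<^sup>2)"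
  unfolding frob2_def by (simp add: mat_trace_gram)

lemma frob2_diagonal:
  assumes D: "D \<in> carrier_mat n n" "diagonal_mat D"
  shows "frob2 D = (\<Sum>i<n. (cmod (D $$ (i, i)))\<^sup>2)"
proof -
  have "(\<Sum>i<n. (cmod (D $$ (i, j)))\<^sup>2) = (cmod (D $$ (j, j)))\<^sup>2" if "j < n" for j
  proof -
    have "(\<Sum>i<n. (cmod (D $$ (i, j)))\<^sup>2) = (\<Sum>i<n. if i = j then (cmod (D $$ (j, j)))\<^sup>2 else 0)"
      using D that unfolding diagonal_mat_def by (intro sum.cong) auto
    then show ?thesis using that by simp
  qed
  then show ?thesis unfolding frob2_eq[OF D(1)] by simp
qed

text \<open>Row \<open>i\<close> of the off-diagonal block form has its only possibly nonzero entry
  in column \<open>flip i\<close>.\<close>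

definition flip :: "nat \<Rightarrow> nat" where "flip i = (if even i then i + 1 else i - 1)"

lemma flip_simps [simp]: "flip 0 = 1" "flip 1 = 0" "flip (Suc 0) = 0" "flip 2 = 3" "flip 3 = 2" 
  by (simp_all add: flip_def)

lemma flip_flip [simp]: "flip (flip i) = i"
  by (auto simp: flip_def elim: oddE)

lemma flip_less [simp]: "i < 4 \<Longrightarrow> flip i < 4"
  using less_4_cases[of i] by auto

lemma sum_flip: "(\<Sum>i<4. f (flip i)) = (\<Sum>i<4. f i)"
  by (simp add: sum_lessThan_4 add_ac)

lemma offdiag_carrier [simp]: "offdiag_block_mat b1 b2 b3 b4 \<in> carrier_mat 4 4"
  by (rule carrier_matI) (simp_all add: offdiag_block_mat_def mat_of_rows_list_def)

lemma offdiag_index: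
  assumes "i < 4" "j < 4"
  shows "offdiag_block_mat b1 b2 b3 b4 $$ (i, j) = (if j = flip i then [b1, b2, b3, b4] ! i else 0)"
  using less_4_cases[OF assms(1)] less_4_cases[OF assms(2)]
  by (elim disjE; simp add: offdiag_block_mat_def mat_of_rows_list_def)

lemma frob2_offdiag:
  "frob2 (offdiag_block_mat b1 b2 b3 b4) = (\<Sum>i<4. (cmod ([b1, b2, b3, b4] ! i))\<^sup>2)"
  unfolding frob2_eq[OF offdiag_carrier]
  by (simp add: sum_lessThan_4 offdiag_index)

subsection \<open>The two largest singular values of a Kronecker sum\<close>

lemma top_two_diag_diag:
  assumes D: "D \<in> carrier_mat 4 4" "diagonal_mat D" and E: "E \<in> carrier_mat 4 4" "diagonal_mat E"
    and trD: "mat_trace D = 0" and trE: "mat_trace E = 0"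
  shows "(singular_values (kron_sum D E) ! 0)\<^sup>2 + (singular_values (kron_sum D E) ! 1)\<^sup>2
    \<le> 2 * (frob2 D + frob2 E)"
proof -
  define X where "X = kron_sum D E"
  have X: "X \<in> carrier_mat 16 16" unfolding X_def using kron_sum_carrier[OF D(1) E(1)] by simp
  define x where "x p = D $$ (p div 4, p div 4) + E $$ (p mod 4, p mod 4)" for p
  have X_index: "X $$ (p, q) = (if p = q then x p else 0)" if "p < 16" "q < 16" for p q
  proof -
    have "p div 4 < 4" "q div 4 < 4" "p mod 4 < 4" "q mod 4 < 4" using that by auto
    moreover have "p = q" if "p div 4 = q div 4" "p mod 4 = q mod 4" using that by (metis div_mult_mod_eq)
    ultimately show ?thesis
      using D E that unfolding X_def diagonal_mat_def by (auto simp: kron_sum_index[of _ 4 _ 4] x_def)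
  qed
  let ?G = "mat_adjoint X * X"
  have G: "?G \<in> carrier_mat 16 16" using X mat_adjoint_carrier[OF X] by auto
  have G_index: "?G $$ (p, q) = (if p = q then of_real ((cmod (x p))\<^sup>2) else 0)"
    if "p < 16" "q < 16" for p q
  proof -
    have "?G $$ (p, q) = (\<Sum>r<16. if r = p then (if p = q then cnj (x p) * x p else 0) else 0)"
      unfolding gram_index[OF X that] using that by (intro sum.cong) (auto simp: X_index)
    then show ?thesis using that by (simp add: complex_norm_square mult.commute del: of_real_power)
  qed
  have "upper_triangular ?G"
  proof (rule upper_triangularI)
    fix i j assume ij: "j < i" "i < dim_row ?G"
    then have "i < 16" using carrier_matD(1)[OF G] by simp
    then show "?G $$ (i, j) = 0" using ij(1) G_index[of i j] by (simp del: index_mult_mat(1))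
  qed
  from char_poly_upper_triangular[OF G this]
  have cp: "char_poly ?G = (\<Prod>c\<leftarrow>diag_mat ?G. [:- c, 1:])" .
  have diag: "diag_mat ?G = map (\<lambda>p. of_real ((cmod (x p))\<^sup>2)) [0..<16]"
    unfolding diag_mat_def using G G_index by (auto simp del: index_mult_mat(1))
  have tr: "(\<Sum>i<4. D $$ (i, i)) = 0" "(\<Sum>i<4. E $$ (i, i)) = 0"
    using trD trE D E unfolding mat_trace_def by auto
  have pair: "(cmod (x p))\<^sup>2 + (cmod (x q))\<^sup>2 \<le> 2 * (frob2 D + frob2 E)" if "p < q" "q < 16" for p q
  proof -
    \<comment> \<open>Different positions on the diagonal come from different index pairs, as
      \<open>diag_pair\<close> requires.\<close>
    have "p div 4 \<noteq> q div 4 \<or> p mod 4 \<noteq> q mod 4" using that by (metis div_mult_mod_eq nat_less_le)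
    then show ?thesis
      unfolding x_def frob2_diagonal[OF D] frob2_diagonal[OF E]
      using diag_pair[OF tr, of "p div 4" "p mod 4" "q div 4" "q mod 4"] that by auto
  qed
  have "sorted_wrt (\<lambda>c d. Re c + Re d \<le> 2 * (frob2 D + frob2 E)) (diag_mat ?G)"
    unfolding diag sorted_wrt_map
    by (rule sorted_wrt_mono_rel[OF _ sorted_wrt_upt]) (use pair in auto)
  from singular_values_top_two[OF X _ cp this] show ?thesis unfolding X_def by simp
qed

lemma top_two_diag_offdiag:
  assumes D: "D \<in> carrier_mat 4 4" "diagonal_mat D" and trD: "mat_trace D = 0"
    and B: "B = offdiag_block_mat b1 b2 b3 b4"
  shows "(singular_values (kron_sum D B) ! 0)\<^sup>2 + (singular_values (kron_sum D B) ! 1)\<^sup>2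
    \<le> 2 * (frob2 D + frob2 B)"
proof -
  define X where "X = kron_sum D B"
  define K where "K = 2 * (frob2 D + frob2 B)"
  have Bc: "B \<in> carrier_mat 4 4" unfolding B by simp
  have X: "X \<in> carrier_mat (8 * 2) (8 * 2)" unfolding X_def using kron_sum_carrier[OF D(1) Bc] by simp
  define a where "a i = D $$ (i, i)" for i
  define \<beta> where "\<beta> i = [b1, b2, b3, b4] ! i" for i
  have D_index: "D $$ (i, j) = (if i = j then a i else 0)" if "i < 4" "j < 4" for i j
    using D that unfolding diagonal_mat_def a_def by auto
  have B_index: "B $$ (i, j) = (if j = flip i then \<beta> i else 0)" if "i < 4" "j < 4" for i j
    unfolding B \<beta>_def by (rule offdiag_index[OF that])
  have X_index: "X $$ (p, q) = (if p = q then a (p div 4) else 0) +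
      (if p div 4 = q div 4 \<and> q mod 4 = flip (p mod 4) then \<beta> (p mod 4) else 0)"
    if "p < 16" "q < 16" for p q
  proof -
    have *: "p div 4 < 4" "q div 4 < 4" "p mod 4 < 4" "q mod 4 < 4" using that by auto
    have "p div 4 = q div 4 \<and> p mod 4 = q mod 4 \<longleftrightarrow> p = q" by (metis div_mult_mod_eq)
    then show ?thesis
      using kron_sum_index[OF D(1) Bc, of p q] that
      unfolding X_def D_index[OF *(1,2)] B_index[OF *(3,4)] by auto
  qed
  \<comment> \<open>\<open>flip\<close> stays within the pairs {0, 1} and {2, 3}, so
    \<open>X\<close> is block diagonal with blocks of size 2.\<close>
  have flip_div: "flip i div 2 = i div 2" for i unfolding flip_def by presburger
  have off: "X $$ (p, q) = 0" if pq: "p < 8 * 2" "q < 8 * 2" "p div 2 \<noteq> q div 2" for p q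
  proof -
    have "p div 2 = q div 2" if "p div 4 = q div 4" "q mod 4 = flip (p mod 4)"
    proof -
      have split: "r div 2 = 2 * (r div 4) + (r mod 4) div 2" for r :: nat by presburger
      have "(q mod 4) div 2 = (p mod 4) div 2" unfolding that(2) by (rule flip_div)
      then show ?thesis unfolding split[of p] split[of q] that(1) by simp
    qed
    then show ?thesis using X_index[of p q] pq by auto
  qed
  define M where "M i = diag_blk 2 X i" for i
  \<comment> \<open>Block \<open>i\<close> combines the diagonal entry \<open>i div 2\<close> of
    \<open>D\<close> with the 2 by 2 block \<open>i mod 2\<close> of \<open>B\<close>: it is
    [[a, u], [v, a]] with \<open>a\<close> short for \<open>a (i div 2)\<close>.\<close>
  define u where "u i = \<beta> (2 * (i mod 2))" for i
  define v where "v i = \<beta> (2 * (i mod 2) + 1)" for i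
  define N where "N i = (cmod (u i))\<^sup>2 + (cmod (v i))\<^sup>2" for i
  define \<alpha> where "\<alpha> i = (cmod (a (i div 2)))\<^sup>2" for i
  have M: "M i \<in> carrier_mat 2 2" for i by (simp add: M_def)
  have M_index: "M i $$ (0, 0) = a (i div 2)" "M i $$ (0, 1) = u i"
      "M i $$ (1, 0) = v i" "M i $$ (1, 1) = a (i div 2)" if i: "i < 8" for i
  proof -
    have d: "(2 * i) div 4 = i div 2" "(2 * i + 1) div 4 = i div 2"
      "(2 * i) mod 4 = 2 * (i mod 2)" "(2 * i + 1) mod 4 = 2 * (i mod 2) + 1" by presburger+
    have f: "flip (2 * (i mod 2)) = 2 * (i mod 2) + 1" "flip (2 * (i mod 2) + 1) = 2 * (i mod 2)"
      by (auto simp: flip_def)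
    note * = X_index[of "2 * i" "2 * i"] X_index[of "2 * i" "2 * i + 1"]
      X_index[of "2 * i + 1" "2 * i"] X_index[of "2 * i + 1" "2 * i + 1"]
    show "M i $$ (0, 0) = a (i div 2)" "M i $$ (0, 1) = u i"
      "M i $$ (1, 0) = v i" "M i $$ (1, 1) = a (i div 2)"
      using * i unfolding d f u_def v_def M_def by (simp_all add: diag_blk_def mult.commute)
  qed
  have G: "mat_adjoint (M i) * M i \<in> carrier_mat 2 2" for i
    using M[of i] mat_adjoint_carrier[OF M[of i]] by auto
  obtain cs where cs: "\<And>i. char_poly (mat_adjoint (M i) * M i) = (\<Prod>c\<leftarrow>cs i. [:- c, 1:])"
    "\<And>i. length (cs i) = 2"
    using char_poly_factorized[OF G] by metis
  have bound: "Re c \<le> 2 * \<alpha> i + N i" "Re c \<le> 4 / 3 * \<alpha> i + 2 * N i"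
    if i: "i < 8" and c: "c \<in> set (cs i)" for i c
  proof -
    have root: "poly (char_poly (mat_adjoint (M i) * M i)) c = 0"
      unfolding cs(1) poly_prod_list using c by (force simp: prod_list_zero_iff)
    have expand: "(\<Sum>k<2. (cmod (\<Sum>j<2. M i $$ (k, j) * w j))\<^sup>2) =
        (cmod (a (i div 2) * w 0 + u i * w 1))\<^sup>2 + (cmod (v i * w 0 + a (i div 2) * w 1))\<^sup>2" for w
      unfolding sum_lessThan_2 M_index[OF i] ..
    have expand': "(\<Sum>j<2. (cmod (w j))\<^sup>2) = (cmod (w 0))\<^sup>2 + (cmod (w 1))\<^sup>2" for w :: "nat \<Rightarrow> complex"
      by (rule sum_lessThan_2)
    \<comment> \<open>Cauchy-Schwarz in each row: the squared norms of the two rows add up to this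
      constant.\<close>
    show "Re c \<le> 2 * \<alpha> i + N i"
    proof (rule gram_root_le[OF M root], unfold expand expand')
      fix w :: "nat \<Rightarrow> complex"
      show "(cmod (a (i div 2) * w 0 + u i * w 1))\<^sup>2 + (cmod (v i * w 0 + a (i div 2) * w 1))\<^sup>2
        \<le> (2 * \<alpha> i + N i) * ((cmod (w 0))\<^sup>2 + (cmod (w 1))\<^sup>2)"
        using add_mono[OF cmod_Cauchy_Schwarz2[of "a (i div 2)" "w 0" "u i" "w 1"]
          cmod_Cauchy_Schwarz2[of "v i" "w 0" "a (i div 2)" "w 1"]]
        unfolding \<alpha>_def N_def by (simp add: algebra_simps)
    qed
    show "Re c \<le> 4 / 3 * \<alpha> i + 2 * N i"
    proof (rule gram_root_le[OF M root], unfold expand expand')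
      fix w :: "nat \<Rightarrow> complex"
      show "(cmod (a (i div 2) * w 0 + u i * w 1))\<^sup>2 + (cmod (v i * w 0 + a (i div 2) * w 1))\<^sup>2
        \<le> (4 / 3 * \<alpha> i + 2 * N i) * ((cmod (w 0))\<^sup>2 + (cmod (w 1))\<^sup>2)"
        unfolding \<alpha>_def N_def by (rule equal_diagonal_bound)
    qed
  qed
  have tr: "(\<Sum>i<4. a i) = 0" using trD D unfolding mat_trace_def a_def by auto
  have fD: "frob2 D = (\<Sum>i<4. (cmod (a i))\<^sup>2)" unfolding a_def by (rule frob2_diagonal[OF D])
  have fB: "frob2 B = N 0 + N 1"
    unfolding B frob2_offdiag N_def u_def v_def \<beta>_def
    by (simp add: sum_lessThan_4 eval_nat_numeral)
  have N_nonneg: "N i \<ge> 0" for i unfolding N_def by simp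
  have N_mod: "N i = N (i mod 2)" for i unfolding N_def u_def v_def by simp
  have N_le: "N i \<le> frob2 B" for i
    using N_nonneg[of 0] N_nonneg[of 1] N_mod[of i] unfolding fB
    by (cases "i mod 2 = 0") (auto simp: mod2_eq_if split: if_splits)
  have \<alpha>_le: "4 / 3 * \<alpha> i \<le> frob2 D" if "i < 8" for i
    unfolding \<alpha>_def fD using that by (intro sum_zero_single[OF tr]) auto
  let ?P = "\<lambda>c d. Re c + Re d \<le> K"
  \<comment> \<open>Two roots of one block sum to the trace of its Gram matrix,
    \<open>2 * \<alpha> i + N i\<close>, and \<open>2 * \<alpha> i\<close> is at most 3/2 of
    \<open>frob2 D\<close>.\<close>
  have same: "sorted_wrt ?P (cs i)" if i: "i < 8" for i
  proof -
    have "sum_list (cs i) = of_real (2 * \<alpha> i + N i)"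
      unfolding sum_roots_char_poly[OF G cs(1)] mat_trace_gram[OF M]
      unfolding sum_lessThan_2 M_index[OF i] \<alpha>_def N_def by simp
    moreover obtain c d where cd: "cs i = [c, d]"
      using cs(2)[of i] by (auto simp: numeral_2_eq_2 length_Suc_conv)
    ultimately have "Re c + Re d = 2 * \<alpha> i + N i" by (simp add: complex_eq_iff)
    moreover have "\<alpha> i \<ge> 0" by (simp add: \<alpha>_def)
    ultimately show ?thesis using N_le[of i] \<alpha>_le[OF i] N_nonneg[of i] unfolding cd K_def by simp
  qed
  have cross: "Re c + Re d \<le> K" if ij: "i < j" "j < 8" and c: "c \<in> set (cs i)" and d: "d \<in> set (cs j)" for i j c d
  proof (cases "i div 2 = j div 2")
    case True
    \<comment> \<open>Both blocks share an entry of \<open>D\<close> and hence use the two different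
      blocks of \<open>B\<close>, so \<open>N i + N j\<close> is all of \<open>frob2 B\<close>. The
      second bound then gives 8/3 \<open>\<alpha> j\<close> + 2 \<open>frob2 B\<close>.\<close>
    then have "i mod 2 = 0" "j mod 2 = 1" using ij by presburger+
    then have "N i + N j = frob2 B" unfolding fB using N_mod[of i] N_mod[of j] by simp
    moreover have "\<alpha> i = \<alpha> j" unfolding \<alpha>_def True ..
    ultimately show ?thesis
      using bound(2)[OF _ c] bound(2)[OF ij(2) d] \<alpha>_le[OF ij(2)] ij unfolding K_def by simp
  next
    case False
    have less: "i div 2 < 4" "j div 2 < 4" using ij by simp_all
    \<comment> \<open>Two different entries of \<open>D\<close> together contribute at most
      \<open>frob2 D\<close>, so the first bound suffices even if both blocks use the same block of
      \<open>B\<close>.\<close>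
    have "\<alpha> i + \<alpha> j \<le> frob2 D"
      using sum_zero_pair[OF tr less False]
        zero_le_power2[of "cmod (a (i div 2) + a (j div 2))"]
      unfolding \<alpha>_def fD by linarith
    then show ?thesis
      using bound(1)[OF _ c] bound(1)[OF ij(2) d] N_le[of i] N_le[of j] ij unfolding K_def by simp
  qed
  have "char_poly (mat_adjoint X * X) = (\<Prod>i\<leftarrow>[0..<8]. char_poly (diag_blk 2 (mat_adjoint X * X) i))"
    by (rule char_poly_block_diag) (use X mat_adjoint_carrier[OF X] gram_off_block[OF X off] in auto)
  also have "\<dots> = (\<Prod>i\<leftarrow>[0..<8]. \<Prod>c\<leftarrow>cs i. [:- c, 1:])"
    by (intro arg_cong[of _ _ prod_list] map_cong refl)
       (simp add: diag_blk_gram[OF X off] flip: cs(1) M_def)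
  also have "\<dots> = (\<Prod>c\<leftarrow>concat (map cs [0..<8]). [:- c, 1:])"
  proof -
    have "(\<Prod>i\<leftarrow>is. \<Prod>c\<leftarrow>cs i. [:- c, 1:]) = (\<Prod>c\<leftarrow>concat (map cs is). [:- c, 1:])" for "is"
      by (induction "is") simp_all
    then show ?thesis .
  qed
  finally have cp: "char_poly (mat_adjoint X * X) = (\<Prod>c\<leftarrow>concat (map cs [0..<8]). [:- c, 1:])" .
  have "sorted_wrt ?P (concat (map cs [0..<8]))"
  proof (rule sorted_wrt_concat)
    show "sorted_wrt ?P xs" if "xs \<in> set (map cs [0..<8])" for xs using that same by auto
    show "sorted_wrt (\<lambda>xs ys. \<forall>x\<in>set xs. \<forall>y\<in>set ys. ?P x y) (map cs [0..<8])"
      unfolding sorted_wrt_map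
      by (rule sorted_wrt_mono_rel[OF _ sorted_wrt_upt]) (use cross in auto)
  qed
  from singular_values_top_two[OF X _ cp this] show ?thesis unfolding X_def K_def by simp
qed

text \<open>A single root is already bounded by \<open>frob2 A + frob2 B\<close>, which is why
  \<open>K\<close> below lacks the factor 2.\<close>

lemma top_two_offdiag_offdiag:
  assumes A: "A = offdiag_block_mat a1 a2 a3 a4" and B: "B = offdiag_block_mat b1 b2 b3 b4"
  shows "(singular_values (kron_sum A B) ! 0)\<^sup>2 + (singular_values (kron_sum A B) ! 1)\<^sup>2
    \<le> 2 * (frob2 A + frob2 B)"
proof -
  define X where "X = kron_sum A B"
  define K where "K = frob2 A + frob2 B"
  have c: "A \<in> carrier_mat 4 4" "B \<in> carrier_mat 4 4" unfolding A B by simp_all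
  have X: "X \<in> carrier_mat (4 * 4) (4 * 4)" unfolding X_def by (rule kron_sum_carrier[OF c])
  define \<alpha> where "\<alpha> i = [a1, a2, a3, a4] ! i" for i
  define \<beta> where "\<beta> i = [b1, b2, b3, b4] ! i" for i
  have A_index: "A $$ (i, j) = (if j = flip i then \<alpha> i else 0)" if "i < 4" "j < 4" for i j
    unfolding A \<alpha>_def by (rule offdiag_index[OF that])
  have B_index: "B $$ (i, j) = (if j = flip i then \<beta> i else 0)" if "i < 4" "j < 4" for i j
    unfolding B \<beta>_def by (rule offdiag_index[OF that])
  define x where "x i = (cmod (\<alpha> i))\<^sup>2" for i
  define y where "y i = (cmod (\<beta> i))\<^sup>2" for i
  \<comment> \<open>The indices \<open>i\<close> and \<open>flip i\<close> are different, so both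
    terms occur in the sum for the norm.\<close>
  have xy: "x i + x (flip i) \<le> frob2 A" "y i + y (flip i) \<le> frob2 B" if "i < 4" for i
    unfolding A B frob2_offdiag x_def y_def \<alpha>_def \<beta>_def
    using less_4_cases[OF that] by (auto simp: sum_lessThan_4)
  have le: "(\<Sum>i<4 * 4. (cmod (\<Sum>j<4 * 4. X $$ (i, j) * v j))\<^sup>2) \<le> K * (\<Sum>j<4 * 4. (cmod (v j))\<^sup>2)" for v
  proof -
    \<comment> \<open>The vector is read as a 4 by 4 array; \<open>A\<close> then acts on the first
      index and \<open>B\<close> on the second.\<close>
    define w where "w p q = v (p * 4 + q)" for p q
    define F where "F p q = (cmod (w p q))\<^sup>2" for p q
    have v: "v j = w (j div 4) (j mod 4)" for j unfolding w_def by simp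
    have row: "(\<Sum>j<4 * 4. X $$ (i, j) * v j) =
        \<alpha> (i div 4) * w (flip (i div 4)) (i mod 4) + \<beta> (i mod 4) * w (i div 4) (flip (i mod 4))"
      if i: "i < 4 * 4" for i
    proof -
      note d = div_mod_less[OF i]
      have "(\<Sum>j<4 * 4. X $$ (i, j) * v j) = (\<Sum>j<4 * 4.
          ((if i mod 4 = j mod 4 then A $$ (i div 4, j div 4) else 0) +
           (if i div 4 = j div 4 then B $$ (i mod 4, j mod 4) else 0)) * w (j div 4) (j mod 4))"
        unfolding X_def v using i by (intro sum.cong refl) (simp add: kron_sum_index[OF c])
      also have "\<dots> = (\<Sum>p<4. \<Sum>q<4. ((if i mod 4 = q then A $$ (i div 4, p) else 0) +
           (if i div 4 = p then B $$ (i mod 4, q) else 0)) * w p q)"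
        by (rule sum_div_mod)
      also have "\<dots> = (\<Sum>p<4. \<Sum>q<4. if q = i mod 4 then A $$ (i div 4, p) * w p (i mod 4) else 0) +
          (\<Sum>p<4. \<Sum>q<4. if p = i div 4 then B $$ (i mod 4, q) * w (i div 4) q else 0)"
        unfolding sum.distrib[symmetric] by (intro sum.cong refl) (auto simp: distrib_right)
      also have "(\<Sum>p<4. \<Sum>q<4. if p = i div 4 then B $$ (i mod 4, q) * w (i div 4) q else 0) =
          (\<Sum>q<4. \<Sum>p<4. if p = i div 4 then B $$ (i mod 4, q) * w (i div 4) q else 0)"
        by (rule sum.swap)
      also have "(\<Sum>p<4. \<Sum>q<4. if q = i mod 4 then A $$ (i div 4, p) * w p (i mod 4) else 0) + \<dots> =
          (\<Sum>p<4. A $$ (i div 4, p) * w p (i mod 4)) + (\<Sum>q<4. B $$ (i mod 4, q) * w (i div 4) q)"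
        using d by simp
      also have "\<dots> = (\<Sum>p<4. if p = flip (i div 4) then \<alpha> (i div 4) * w p (i mod 4) else 0) +
          (\<Sum>q<4. if q = flip (i mod 4) then \<beta> (i mod 4) * w (i div 4) q else 0)"
        using d by (intro arg_cong2[of _ _ _ _ "(+)"] sum.cong refl) (auto simp: A_index B_index)
      finally show ?thesis using d by simp
    qed
    have "(\<Sum>i<4 * 4. (cmod (\<Sum>j<4 * 4. X $$ (i, j) * v j))\<^sup>2) =
        (\<Sum>i<4 * 4. (cmod (\<alpha> (i div 4) * w (flip (i div 4)) (i mod 4) +
          \<beta> (i mod 4) * w (i div 4) (flip (i mod 4))))\<^sup>2)"
      by (intro sum.cong refl) (simp only: row lessThan_iff)
    also have "\<dots> = (\<Sum>p<4. \<Sum>q<4. (cmod (\<alpha> p * w (flip p) q + \<beta> q * w p (flip q)))\<^sup>2)"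
      by (rule sum_div_mod)
    also have "\<dots> \<le> (\<Sum>p<4. \<Sum>q<4. (x p + y q) * (F (flip p) q + F p (flip q)))"
      unfolding x_def y_def F_def by (intro sum_mono cmod_Cauchy_Schwarz2)
    also have "\<dots> = (\<Sum>p<4. \<Sum>q<4. (x p + y q) * F (flip p) q) + (\<Sum>p<4. \<Sum>q<4. (x p + y q) * F p (flip q))"
      by (simp add: distrib_left sum.distrib)
    \<comment> \<open>Reindexing by the involution \<open>flip\<close> moves it from
      \<open>F\<close> to the weights, here to \<open>x\<close> and next to \<open>y\<close>, so
      that the coefficients of each \<open>F p q\<close> can be collected and bounded by
      \<open>K\<close>.\<close>
    also have "(\<Sum>p<4. \<Sum>q<4. (x p + y q) * F (flip p) q) = (\<Sum>p<4. \<Sum>q<4. (x (flip p) + y q) * F p q)"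
      using sum_flip[of "\<lambda>p. \<Sum>q<4. (x (flip p) + y q) * F p q"] by simp
    also have "(\<Sum>p<4. \<Sum>q<4. (x p + y q) * F p (flip q)) = (\<Sum>p<4. \<Sum>q<4. (x p + y (flip q)) * F p q)"
      using sum_flip[of "\<lambda>q. (x p + y (flip q)) * F p q" for p] by simp
    also have "(\<Sum>p<4. \<Sum>q<4. (x (flip p) + y q) * F p q) + (\<Sum>p<4. \<Sum>q<4. (x p + y (flip q)) * F p q) =
        (\<Sum>p<4. \<Sum>q<4. ((x p + x (flip p)) + (y q + y (flip q))) * F p q)"
      unfolding sum.distrib[symmetric] by (intro sum.cong refl) (simp add: algebra_simps)
    also have "\<dots> \<le> (\<Sum>p<4. \<Sum>q<4. K * F p q)"
      unfolding K_def by (intro sum_mono mult_right_mono add_mono xy) (auto simp: F_def)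
    also have "\<dots> = K * (\<Sum>p<4. \<Sum>q<4. F p q)" by (simp add: sum_distrib_left)
    also have "(\<Sum>p<4. \<Sum>q<4. F p q) = (\<Sum>j<4 * 4. (cmod (v j))\<^sup>2)"
      unfolding v F_def by (rule sum_div_mod[symmetric])
    finally show ?thesis .
  qed
  have "mat_adjoint X * X \<in> carrier_mat (4 * 4) (4 * 4)" using X mat_adjoint_carrier[OF X] by auto
  from char_poly_factorized[OF this] obtain cs where
    cp: "char_poly (mat_adjoint X * X) = (\<Prod>c\<leftarrow>cs. [:- c, 1:])" by blast
  have "Re c \<le> K" if "c \<in> set cs" for c
  proof (rule gram_root_le[OF X _ le])
    show "poly (char_poly (mat_adjoint X * X)) c = 0"
      unfolding cp poly_prod_list using that by (force simp: prod_list_zero_iff)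
  qed
  then have "Re c + Re d \<le> 2 * K" if "c \<in> set cs" "d \<in> set cs" for c d
    using that by (metis add_mono mult_2)
  then have "sorted_wrt (\<lambda>c d. Re c + Re d \<le> 2 * K) cs"
    by (induction cs) auto
  from singular_values_top_two[OF X _ cp this] show ?thesis unfolding X_def K_def by simp
qed

text \<open>The last two properties carry the trace condition and the norm over to the diagonal
  matrix.\<close>

lemma normal_mat_diagonalize:
  assumes A: "A \<in> carrier_mat n n" and N: "normal_mat A"
  obtains U D where "unitary_mat n U" "D \<in> carrier_mat n n" "diagonal_mat D" "A * U = U * D"
    "mat_trace D = mat_trace A" "frob2 D = frob2 A"
proof -
  obtain U D where U: "unitary_mat n U" and D: "D \<in> carrier_mat n n" "diagonal_mat D"
    and AU: "A * U = U * D" using normal_mat_unitary_diag[OF A N] by blast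
  note u = unitary_matD[OF U]
  have "A = A * (U * mat_adjoint U)" using A u by simp
  also have "\<dots> = U * D * mat_adjoint U"
    using A u(1,2) by (simp add: AU flip: assoc_mult_mat[of _ n n _ n _ n])
  finally have "similar_mat A D"
    using A D u by (intro similar_matI[of A D U "mat_adjoint U" n]) auto
  then have "mat_trace D = mat_trace A" by (simp add: mat_trace_similar)
  moreover have "frob2 D = frob2 A"
    unfolding frob2_def by (simp add: mat_trace_similar[OF gram_eq_conj[OF A D(1) U AU]])
  ultimately show thesis using that U D AU by blast
qed

lemma top_two_normal_offdiag:
  assumes A: "A \<in> carrier_mat 4 4" "normal_mat A" and trA: "mat_trace A = 0"
    and B: "B = offdiag_block_mat b1 b2 b3 b4"
  shows "(singular_values (kron_sum A B) ! 0)\<^sup>2 + (singular_values (kron_sum A B) ! 1)\<^sup>2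
    \<le> 2 * (frob2 A + frob2 B)"
proof -
  obtain U D where U: "unitary_mat 4 U" and D: "D \<in> carrier_mat 4 4" "diagonal_mat D"
    and AU: "A * U = U * D" and inv: "mat_trace D = mat_trace A" "frob2 D = frob2 A"
    by (rule normal_mat_diagonalize[OF A])
  have Bc: "B \<in> carrier_mat 4 4" unfolding B by simp
  \<comment> \<open>The basis of the second factor is kept, so that \<open>B\<close> retains its
    off-diagonal form.\<close>
  have "B * 1\<^sub>m 4 = 1\<^sub>m 4 * B" using Bc by simp
  from kron_sum_conj[OF A(1) D(1) Bc Bc unitary_matD(1)[OF U] one_carrier_mat AU this]
  have "singular_values (kron_sum A B) = singular_values (kron_sum D B)"
    by (rule singular_values_unitary_equiv[OF kron_sum_carrier[OF A(1) Bc] kron_sum_carrier[OF D(1) Bc]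
        unitary_mat_kronecker[OF U unitary_mat_one]])
  with top_two_diag_offdiag[OF D _ B] show ?thesis using inv trA by simp
qed

lemma top_two_normal_normal:
  assumes A: "A \<in> carrier_mat 4 4" "normal_mat A" and trA: "mat_trace A = 0"
    and B: "B \<in> carrier_mat 4 4" "normal_mat B" and trB: "mat_trace B = 0"
  shows "(singular_values (kron_sum A B) ! 0)\<^sup>2 + (singular_values (kron_sum A B) ! 1)\<^sup>2
    \<le> 2 * (frob2 A + frob2 B)"
proof -
  obtain U D where U: "unitary_mat 4 U" and D: "D \<in> carrier_mat 4 4" "diagonal_mat D"
    and AU: "A * U = U * D" and invA: "mat_trace D = mat_trace A" "frob2 D = frob2 A"
    by (rule normal_mat_diagonalize[OF A])
  obtain V E where V: "unitary_mat 4 V" and E: "E \<in> carrier_mat 4 4" "diagonal_mat E"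
    and BV: "B * V = V * E" and invB: "mat_trace E = mat_trace B" "frob2 E = frob2 B"
    by (rule normal_mat_diagonalize[OF B])
  from kron_sum_conj[OF A(1) D(1) B(1) E(1) unitary_matD(1)[OF U] unitary_matD(1)[OF V] AU BV]
  have "singular_values (kron_sum A B) = singular_values (kron_sum D E)"
    by (rule singular_values_unitary_equiv[OF kron_sum_carrier[OF A(1) B(1)] kron_sum_carrier[OF D(1) E(1)]
        unitary_mat_kronecker[OF U V]])
  with top_two_diag_diag[OF D E] show ?thesis using invA invB trA trB by simp
qed

theorem theorem1:
  fixes A B X :: "complex mat"
  assumes A: "A \<in> carrier_mat 4 4"
    and B: "B \<in> carrier_mat 4 4"
    and trA: "mat_trace A = 0"
    and trB: "mat_trace B = 0"
    and norm: "mat_trace (mat_adjoint A * A) + mat_trace (mat_adjoint B * B) = 1 / 4"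
    and formA: "normal_mat A \<or> (\<exists>a1 a2 a3 a4. A = offdiag_block_mat a1 a2 a3 a4)"
    and formB: "normal_mat B \<or> (\<exists>b1 b2 b3 b4. B = offdiag_block_mat b1 b2 b3 b4)"
    and X: "X = kronecker A (1\<^sub>m 4) + kronecker (1\<^sub>m 4) B"
  shows "(singular_values X ! 0)\<^sup>2 + (singular_values X ! 1)\<^sup>2 \<le> 1 / 2"
proof -
  have X': "X = kron_sum A B" unfolding X kron_sum_def using A B by auto
  \<comment> \<open>Flipping the factors reduces an off-diagonal \<open>A\<close> with a normal
    \<open>B\<close> to the mixed case with the normal factor first.\<close>
  obtain P where P: "unitary_mat (4 * 4) P" "kron_sum A B * P = P * kron_sum B A"
    using kron_sum_swap[OF A B] by blast
  have swap: "singular_values (kron_sum A B) = singular_values (kron_sum B A)"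
    by (rule singular_values_unitary_equiv[OF kron_sum_carrier[OF A B] kron_sum_carrier[OF B A] P])
  have "(singular_values X ! 0)\<^sup>2 + (singular_values X ! 1)\<^sup>2 \<le> 2 * (frob2 A + frob2 B)"
  proof (cases "normal_mat A")
    case True
    then show ?thesis
      using top_two_normal_normal[OF A _ trA B _ trB] top_two_normal_offdiag[OF A _ trA] formB
      unfolding X' by blast
  next
    case False
    then obtain a1 a2 a3 a4 where offA: "A = offdiag_block_mat a1 a2 a3 a4" using formA by blast
    show ?thesis
    proof (cases "normal_mat B")
      case True
      then show ?thesis
        using top_two_normal_offdiag[OF B _ trB offA] unfolding X' swap by (simp add: add.commute)
    next
      case False
      then show ?thesis using top_two_offdiag_offdiag[OF offA] formB unfolding X' by blast
    qed
  qed
  moreover have "frob2 A + frob2 B = 1 / 4"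
    using arg_cong[OF norm, of Re] unfolding frob2_def by simp
  ultimately show ?thesis by simp
qed

end
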